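(* Let $(E_0,E_1)$, $(F_0,F_1)$ and $(G_0,G_1)$ be Banach couples. Let $T$ be a bounded bilinear operator from $(E_0+E_1)\times(F_0+F_1)$ into $G_0+G_1$ whose restrictions $T|_{E_k\times F_k}$ $(k=0,1)$ are bounded from $E_k\times F_k$ into $G_k$ $(k=0,1)$. Then, for $\rho\in\mathcal{B}^{+-}$, one has $$T:(E_0,E_1)_{\gamma,p}\times(F_0,F_1)_{\rho,q}\longrightarrow(G_0,G_1)_{\rho,r},$$ where $\gamma(t)=\overline{\rho}(t^{-1})^{-1}\in\mathcal{B}^{+-}$, $1/r=1/p+1/q-1$, and $$\|T\|_{Bil((E_0,E_1)_{\gamma,p}\times(F_0,F_1)_{\rho,q},\,(G_0,G_1)_{\rho,r})}\le C\,\|T\|_{Bil(E_0\times F_0,G_0)}\;\overline{\rho}\!\left(\frac{\|T\|_{Bil(E_1\times F_1,G_1)}}{\|T\|_{Bil(E_0\times F_0,G_0)}}\right),$$ where $C>0$ is a constant.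
   Context: A Banach couple $(X_0,X_1)$ is a pair of Banach spaces continuously embedded in some Hausdorff linear topological space. $X_0\cap X_1$ has norm $\max\{\|x\|_{X_0},\|x\|_{X_1}\}$ and $X_0+X_1$ has norm $\inf_{x=x_0+x_1}(\|x_0\|_{X_0}+\|x_1\|_{X_1})$. For Banach spaces $X,Y,Z$, $Bil(X\times Y,Z)$ is the space of bilinear operators from $X\times Y$ into $Z$ with norm $\|T\|_{Bil(X\times Y,Z)}=\sup\{\|T(x,y)\|_Z:\|x\|_X\le1,\ \|y\|_Y\le1\}$. A function parameter is a continuous positive function $\rho$ on $(0,\infty)$. It belongs to the class $\mathcal{B}$ if $\rho(1)=1$ and $\overline{\rho}(s)=\sup_{t>0}\rho(st)/\rho(t)<\infty$ for all $s>0$. A parameter $\rho\in\mathcal{B}$ belongs to the class $\mathcal{B}^{+-}$ if moreover $\int_0^\infty\min(1,1/t)\,\overline{\rho}(t)\,\frac{dt}{t}<\infty$. For $x\in X_0\cap X_1$ and $t>0$ put $J(t,x)=\max\{\|x\|_{X_0},t\|x\|_{X_1}\}$. For a parameter $f\in\mathcal{B}^{+-}$ and an exponent $0<s\le\infty$, $(X_0,X_1)_{f,s}=(X_0,X_1)_{f,s;J}$ is the set of $x\in X_0+X_1$ having a representation $x=\sum_{n\in\mathbb{Z}}u_n$ (convergence in $X_0+X_1$) with $u_n\in X_0\cap X_1$, for which $$\|x\|_{f,s;J}=\inf\big\|\big(f(2^n)^{-1}J(2^n,u_n)\big)_{n\in\mathbb{Z}}\big\|_{\ell^s(\mathbb{Z})}<\infty,$$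 the infimum being over all such representations. It coincides with the space defined by the norm $\|(f(2^n)^{-1}K(2^n,x))_{n\in\mathbb{Z}}\|_{\ell^s(\mathbb{Z})}$, where $K(t,x)=\inf_{x=x_0+x_1}(\|x_0\|_{X_0}+t\|x_1\|_{X_1})$.
   Formalization: The exponents are restricted to p,q ≥ 1 (the claim fails for p<1, and for q<1 when ρ is a power), and γ is shown to satisfy all conditions of B^{+-} except continuity, which can fail for some ρ; γ ∈ B^{+-} holds whenever γ is continuous. *)

theory Defs
  imports "HOL-Analysis.Analysis"
begin

section \<open>Normed spaces living inside an ambient vector space\<close>

text \<open>
  All spaces of a couple are linear subspaces of one real vector space \<open>'v\<close>, each with its own
  norm, so that intersections, sums and interpolation spaces can be formed.  Only the values of
  \<open>nrm X\<close> on \<open>pts X\<close> matter.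
\<close>

record 'v nspace =
  pts :: "'v set"
  nrm :: "'v \<Rightarrow> real"

definition normed_space :: "'v::real_vector nspace \<Rightarrow> bool" where
  "normed_space X \<longleftrightarrow>
     subspace (pts X) \<and>
     (\<forall>x\<in>pts X. 0 \<le> nrm X x \<and> (nrm X x = 0 \<longleftrightarrow> x = 0)) \<and>
     (\<forall>c. \<forall>x\<in>pts X. nrm X (c *\<^sub>R x) = \<bar>c\<bar> * nrm X x) \<and>
     (\<forall>x\<in>pts X. \<forall>y\<in>pts X. nrm X (x + y) \<le> nrm X x + nrm X y)"

text \<open>
  The locale \<open>Metric_space\<close> demands nonnegativity and symmetry also off the carrier, hence the
  value \<open>0\<close> there.
\<close>

definition ndist :: "'v::real_vector nspace \<Rightarrow> 'v \<Rightarrow> 'v \<Rightarrow> real" where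
  "ndist X x y = (if x \<in> pts X \<and> y \<in> pts X then nrm X (x - y) else 0)"

definition banach_space :: "'v::real_vector nspace \<Rightarrow> bool" where
  "banach_space X \<longleftrightarrow> normed_space X \<and> Metric_space.mcomplete (pts X) (ndist X)"

definition hausdorff_linear_topology :: "'v::real_vector topology \<Rightarrow> bool" where
  "hausdorff_linear_topology \<tau> \<longleftrightarrow>
     topspace \<tau> = UNIV \<and> Hausdorff_space \<tau> \<and>
     continuous_map (prod_topology \<tau> \<tau>) \<tau> (\<lambda>(x, y). x + y) \<and>
     continuous_map (prod_topology euclideanreal \<tau>) \<tau> (\<lambda>(c, x). c *\<^sub>R x)"

definition continuously_embedded :: "'v::real_vector nspace \<Rightarrow> 'v topology \<Rightarrow> bool" where
  "continuously_embedded X \<tau> \<longleftrightarrow>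
     continuous_map (Metric_space.mtopology (pts X) (ndist X)) \<tau> (\<lambda>x. x)"

definition banach_couple :: "'v::real_vector nspace \<Rightarrow> 'v nspace \<Rightarrow> bool" where
  "banach_couple X0 X1 \<longleftrightarrow>
     banach_space X0 \<and> banach_space X1 \<and>
     (\<exists>\<tau>. hausdorff_linear_topology \<tau> \<and>
          continuously_embedded X0 \<tau> \<and> continuously_embedded X1 \<tau>)"

definition inter_space :: "'v nspace \<Rightarrow> 'v nspace \<Rightarrow> 'v nspace" where
  "inter_space X0 X1 = \<lparr>pts = pts X0 \<inter> pts X1, nrm = (\<lambda>x. max (nrm X0 x) (nrm X1 x))\<rparr>"

definition sum_space :: "'v::real_vector nspace \<Rightarrow> 'v nspace \<Rightarrow> 'v nspace" where
  "sum_space X0 X1 =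
     \<lparr>pts = {x0 + x1 | x0 x1. x0 \<in> pts X0 \<and> x1 \<in> pts X1},
      nrm = (\<lambda>x. Inf {nrm X0 x0 + nrm X1 x1 | x0 x1.
                        x0 \<in> pts X0 \<and> x1 \<in> pts X1 \<and> x = x0 + x1})\<rparr>"


section \<open>Bounded bilinear operators\<close>

definition bilinear_between ::
  "'x::real_vector nspace \<Rightarrow> 'y::real_vector nspace \<Rightarrow> 'z::real_vector nspace \<Rightarrow>
   ('x \<Rightarrow> 'y \<Rightarrow> 'z) \<Rightarrow> bool" where
  "bilinear_between X Y Z T \<longleftrightarrow>
     (\<forall>x\<in>pts X. \<forall>y\<in>pts Y. T x y \<in> pts Z) \<and>
     (\<forall>x\<in>pts X. \<forall>x'\<in>pts X. \<forall>y\<in>pts Y. T (x + x') y = T x y + T x' y) \<and>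
     (\<forall>x\<in>pts X. \<forall>y\<in>pts Y. \<forall>y'\<in>pts Y. T x (y + y') = T x y + T x y') \<and>
     (\<forall>c. \<forall>x\<in>pts X. \<forall>y\<in>pts Y. T (c *\<^sub>R x) y = c *\<^sub>R T x y \<and> T x (c *\<^sub>R y) = c *\<^sub>R T x y)"

definition unit_values ::
  "'x nspace \<Rightarrow> 'y nspace \<Rightarrow> 'z nspace \<Rightarrow> ('x \<Rightarrow> 'y \<Rightarrow> 'z) \<Rightarrow> real set" where
  "unit_values X Y Z T =
     {nrm Z (T x y) | x y. x \<in> pts X \<and> y \<in> pts Y \<and> nrm X x \<le> 1 \<and> nrm Y y \<le> 1}"

definition Bil ::
  "'x::real_vector nspace \<Rightarrow> 'y::real_vector nspace \<Rightarrow> 'z::real_vector nspace \<Rightarrow>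
   ('x \<Rightarrow> 'y \<Rightarrow> 'z) set" where
  "Bil X Y Z = {T. bilinear_between X Y Z T \<and> bdd_above (unit_values X Y Z T)}"

definition bil_norm ::
  "'x nspace \<Rightarrow> 'y nspace \<Rightarrow> 'z nspace \<Rightarrow> ('x \<Rightarrow> 'y \<Rightarrow> 'z) \<Rightarrow> real" where
  "bil_norm X Y Z T = Sup (unit_values X Y Z T)"


section \<open>Function parameters\<close>

text \<open>Parameters live on \<open>(0,\<infinity>)\<close>; their values at nonpositive arguments are never used.\<close>

definition function_parameter :: "(real \<Rightarrow> real) \<Rightarrow> bool" where
  "function_parameter \<rho> \<longleftrightarrow> continuous_on {0<..} \<rho> \<and> (\<forall>t>0. 0 < \<rho> t)"

definition dil_finite :: "(real \<Rightarrow> real) \<Rightarrow> real \<Rightarrow> bool" where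
  "dil_finite \<rho> s \<longleftrightarrow> bdd_above ((\<lambda>t. \<rho> (s * t) / \<rho> t) ` {0<..})"

text \<open>
  \<open>dil \<rho>\<close> is the function \<open>\<rho>\<close> with a bar, a real supremum that is meaningful when \<open>dil_finite\<close>
  holds.  It is extended by \<open>0\<close> to \<open>s \<le> 0\<close>; for \<open>\<rho>\<close> in \<open>\<B>\<^sup>+\<^sup>-\<close> this is the limit at \<open>0\<close>.
\<close>

definition dil :: "(real \<Rightarrow> real) \<Rightarrow> real \<Rightarrow> real" where
  "dil \<rho> s = (if 0 < s then SUP t\<in>{0<..}. \<rho> (s * t) / \<rho> t else 0)"

definition class_B :: "(real \<Rightarrow> real) \<Rightarrow> bool" where
  "class_B \<rho> \<longleftrightarrow> function_parameter \<rho> \<and> \<rho> 1 = 1 \<and> (\<forall>s>0. dil_finite \<rho> s)"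

definition dil_integral :: "(real \<Rightarrow> real) \<Rightarrow> ennreal" where
  "dil_integral \<rho> = (\<integral>\<^sup>+t\<in>{0<..}. ennreal (min 1 (1 / t) * dil \<rho> t / t) \<partial>lborel)"

definition class_Bpm :: "(real \<Rightarrow> real) \<Rightarrow> bool" where
  "class_Bpm \<rho> \<longleftrightarrow> class_B \<rho> \<and> dil_integral \<rho> < \<infinity>"


section \<open>The J-method\<close>

definition in_ell :: "ereal \<Rightarrow> (int \<Rightarrow> real) \<Rightarrow> bool" where
  "in_ell s a \<longleftrightarrow>
     (if s = \<infinity> then bdd_above (range (\<lambda>n. \<bar>a n\<bar>))
      else (\<lambda>n. \<bar>a n\<bar> powr real_of_ereal s) summable_on UNIV)"

definition ell_norm :: "ereal \<Rightarrow> (int \<Rightarrow> real) \<Rightarrow> real" where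
  "ell_norm s a =
     (if s = \<infinity> then (SUP n. \<bar>a n\<bar>)
      else (\<Sum>\<^sub>\<infinity>n. \<bar>a n\<bar> powr real_of_ereal s) powr (1 / real_of_ereal s))"

definition J_fun :: "'v nspace \<Rightarrow> 'v nspace \<Rightarrow> real \<Rightarrow> 'v \<Rightarrow> real" where
  "J_fun X0 X1 t x = max (nrm X0 x) (t * nrm X1 x)"

definition bilateral_sums :: "'v::real_vector nspace \<Rightarrow> (int \<Rightarrow> 'v) \<Rightarrow> 'v \<Rightarrow> bool" where
  "bilateral_sums X u x \<longleftrightarrow>
     (\<forall>e>0. \<exists>N::nat. \<forall>m\<ge>N. \<forall>n\<ge>N. nrm X (x - (\<Sum>k\<in>{- int m..int n}. u k)) < e)"

definition J_rep :: "'v::real_vector nspace \<Rightarrow> 'v nspace \<Rightarrow> 'v \<Rightarrow> (int \<Rightarrow> 'v) \<Rightarrow> bool" where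
  "J_rep X0 X1 x u \<longleftrightarrow>
     (\<forall>n. u n \<in> pts (inter_space X0 X1)) \<and> bilateral_sums (sum_space X0 X1) u x"

definition J_seq ::
  "'v nspace \<Rightarrow> 'v nspace \<Rightarrow> (real \<Rightarrow> real) \<Rightarrow> (int \<Rightarrow> 'v) \<Rightarrow> int \<Rightarrow> real" where
  "J_seq X0 X1 f u n = inverse (f (2 powi n)) * J_fun X0 X1 (2 powi n) (u n)"

text \<open>
  Finiteness of the infimum means that some representation has its \<open>J_seq\<close> in \<open>\<ell>\<^sup>s\<close>; the
  infimum is taken over these representations (the others would contribute \<open>\<infinity>\<close>).
\<close>

definition J_space ::
  "'v::real_vector nspace \<Rightarrow> 'v nspace \<Rightarrow> (real \<Rightarrow> real) \<Rightarrow> ereal \<Rightarrow> 'v nspace" where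
  "J_space X0 X1 f s =
     \<lparr>pts = {x \<in> pts (sum_space X0 X1). \<exists>u. J_rep X0 X1 x u \<and> in_ell s (J_seq X0 X1 f u)},
      nrm = (\<lambda>x. Inf {ell_norm s (J_seq X0 X1 f u) | u.
                        J_rep X0 X1 x u \<and> in_ell s (J_seq X0 X1 f u)})\<rparr>"

end

theory Submission
  imports Defs
begin

text \<open>
  Take representations \<open>x = \<Sum> u\<^sub>k\<close> and \<open>y = \<Sum> v\<^sub>l\<close> and group \<open>T x y = \<Sum> T u\<^sub>k v\<^sub>l\<close> along the diagonals
  \<open>k + l = n + m\<close>, where \<open>2\<^sup>m\<close> is comparable to the quotient of the norms of \<open>T\<close> on the two endpoints.
  Since \<open>\<rho>(2\<^sup>l) \<le> \<gamma>(2\<^sup>k)\<inverse> \<rho>(2\<^sup>k\<^sup>+\<^sup>l)\<close>, the weighted J-functionals of the diagonal sums are dominated by the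
  convolution of those of \<open>u\<close> and \<open>v\<close>, and Young's inequality gives the estimate.  Both series
  converge absolutely in the sum spaces because of the integrability condition on the dilation
  function, which justifies the regrouping.  The constant comes from the local boundedness of the
  dilation function, a consequence of Baire's theorem.
\<close>

section \<open>Dilation functions\<close>

text \<open>The ambient vector spaces carry no series of their own, so a diagonal sum is known only
  through what is used later: membership in both endpoint spaces, a bound on its J-functional, and
  tail estimates in the norm of the sum space, which is treated as a seminorm throughout. Neither
  Young's inequality nor the endpoint bounds lose a constant. The only loss occurs when the quotient
  of the endpoint norms is rounded up to a power of two, so C is a local bound of
  \<open>dil \<rho>\<close> and depends on \<rho> alone. If an endpoint norm vanishes, this quotient
  has no usable logarithm; \<open>T x y\<close> is then shown to be a null vector instead. As a
  supremum of continuous functions \<open>dil \<rho>\<close> is lower semicontinuous, but it may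
  jump. Hence local boundedness calls for a category argument, and membership of \<gamma> in the
  class is asserted under continuity of \<gamma>, the other conditions being proved
  outright.\<close>

lemma class_B_pos: "class_B \<rho> \<Longrightarrow> 0 < t \<Longrightarrow> 0 < \<rho> t"
  by (simp add: class_B_def function_parameter_def)

lemma le_dil:
  assumes "class_B \<rho>" "0 < s" "0 < t"
  shows "\<rho> (s * t) \<le> dil \<rho> s * \<rho> t"
proof -
  have "bdd_above ((\<lambda>t. \<rho> (s * t) / \<rho> t) ` {0<..})"
    using assms by (simp add: class_B_def dil_finite_def)
  then have "\<rho> (s * t) / \<rho> t \<le> dil \<rho> s"
    using assms by (auto simp: dil_def intro!: cSUP_upper)
  then show ?thesis
    using class_B_pos[OF assms(1,3)] by (simp add: pos_divide_le_eq)
qed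

lemma dil_le:
  assumes "\<And>t. 0 < t \<Longrightarrow> 0 < \<rho> t" "0 < s" "\<And>t. 0 < t \<Longrightarrow> \<rho> (s * t) \<le> c * \<rho> t"
  shows "dil_finite \<rho> s" "dil \<rho> s \<le> c"
proof -
  have *: "\<rho> (s * t) / \<rho> t \<le> c" if "0 < t" for t
    using assms that by (simp add: pos_divide_le_eq)
  then show "dil_finite \<rho> s"
    unfolding dil_finite_def by (intro bdd_aboveI[of _ c]) auto
  show "dil \<rho> s \<le> c"
    using * assms(2) by (auto simp: dil_def intro!: cSUP_least)
qed

lemma dil_pos:
  assumes "class_B \<rho>" "0 < s"
  shows "0 < dil \<rho> s"
proof -
  have "\<rho> (s * 1) \<le> dil \<rho> s * \<rho> 1"
    using assms by (intro le_dil) auto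
  moreover have "0 < \<rho> (s * 1)" "\<rho> 1 = 1"
    using assms class_B_pos[of \<rho> s] by (auto simp: class_B_def)
  ultimately show ?thesis by simp
qed

lemma dil_one:
  assumes "class_B \<rho>"
  shows "dil \<rho> 1 = 1"
proof (rule antisym)
  show "dil \<rho> 1 \<le> 1"
    using class_B_pos[OF assms] by (intro dil_le) auto
  show "1 \<le> dil \<rho> 1"
    using le_dil[OF assms, of 1 1] assms by (simp add: class_B_def)
qed

lemma dil_mult_le:
  assumes "class_B \<rho>" "0 < s" "0 < u"
  shows "dil \<rho> (s * u) \<le> dil \<rho> s * dil \<rho> u"
proof (rule dil_le)
  fix t :: real assume "0 < t"
  then have "\<rho> (s * (u * t)) \<le> dil \<rho> s * \<rho> (u * t)"
    using assms by (intro le_dil) auto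
  also have "\<dots> \<le> dil \<rho> s * (dil \<rho> u * \<rho> t)"
    using assms \<open>0 < t\<close> dil_pos[OF assms(1,2)] by (intro mult_left_mono le_dil) auto
  finally show "\<rho> (s * u * t) \<le> dil \<rho> s * dil \<rho> u * \<rho> t"
    by (simp add: mult.assoc)
qed (use assms class_B_pos in auto)

text \<open>
  The sublevel sets of the dilation function are closed because \<open>\<rho>\<close> is continuous, so by Baire's
  theorem one of them contains an interval; submultiplicativity propagates the bound.
\<close>

lemma dil_bounded_on_interval:
  assumes "class_B \<rho>"
  obtains c d K where "1 \<le> c" "c < d" "\<And>s. s \<in> {c..d} \<Longrightarrow> dil \<rho> s \<le> K"
proof -
  \<comment> \<open>\<open>F n\<close> is the sublevel set of \<open>dil \<rho>\<close> at height n
    in [1,2], written without the supremum: one closed condition for each t.\<close>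
  define F where "F n = {s\<in>{1..2}. \<forall>t>0. \<rho> (s * t) \<le> real n * \<rho> t}" for n
  have closed: "closed (F n)" for n
  proof -
    have "closed {s\<in>{1..2}. \<rho> (s * t) \<le> real n * \<rho> t}" if "0 < t" for t
    proof (rule continuous_on_closed_Collect_le)
      have "continuous_on {0<..} \<rho>"
        using assms by (simp add: class_B_def function_parameter_def)
      then show "continuous_on {1..2} (\<lambda>s. \<rho> (s * t))"
        by (rule continuous_on_compose2) (use that in \<open>auto intro!: continuous_intros\<close>)
    qed auto
    then have "closed (\<Inter>t\<in>{0<..}. {s\<in>{1..2}. \<rho> (s * t) \<le> real n * \<rho> t})"
      by (intro closed_INT) auto
    also have "(\<Inter>t\<in>{0<..}. {s\<in>{1..2}. \<rho> (s * t) \<le> real n * \<rho> t}) = F n"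
      by (auto simp: F_def intro: zero_less_one)
    finally show ?thesis .
  qed
  have cover: "\<exists>n. s \<in> F n" if "s \<in> {1..2}" for s
  proof -
    obtain n where n: "dil \<rho> s \<le> real n"
      using real_arch_simple by blast
    have "\<rho> (s * t) \<le> real n * \<rho> t" if "0 < t" for t
      using order_trans[OF le_dil[OF assms, of s t] mult_right_mono[OF n, of "\<rho> t"]]
        class_B_pos[OF assms that] \<open>s \<in> {1..2}\<close> that by simp
    then show ?thesis
      using that by (auto simp: F_def)
  qed
  \<comment> \<open>Otherwise all complements of the \<open>F n\<close> are dense and relatively
    open in [1,2], and Baire's theorem makes their intersection dense; but it is empty because the
    \<open>F n\<close> cover [1,2].\<close>
  have "\<exists>n. \<not> {1..2} \<subseteq> closure ({1..2} - F n)"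
  proof (rule ccontr)
    assume "\<not> ?thesis"
    then have "{1..2} \<subseteq> closure (\<Inter>n. {1..2::real} - F n)"
      using closed by (intro Baire) (auto simp: openin_open intro!: exI[of _ "- F _"])
    moreover have "(\<Inter>n. {1..2::real} - F n) = {}"
      using cover by blast
    ultimately have "{1..2::real} \<subseteq> {}"
      by (simp only: closure_empty)
    then show False by simp
  qed
  then obtain n x where x: "x \<in> {1..2}" "x \<notin> closure ({1..2} - F n)"
    by blast
  then obtain e where e: "0 < e" "\<And>y. y \<in> {1..2} - F n \<Longrightarrow> e \<le> dist y x"
    unfolding closure_approachable by (meson not_less)
  \<comment> \<open>Half the radius keeps the closed interval inside the open ball around x;
    clipping to [1,2] leaves it nondegenerate even if x is an endpoint.\<close>
  define c d where "c = max 1 (x - e / 2)" and "d = min 2 (x + e / 2)"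
  show ?thesis
  proof (rule that)
    show "1 \<le> c" "c < d"
      using x e by (auto simp: c_def d_def)
    fix s assume s: "s \<in> {c..d}"
    then have "dist s x < e" "s \<in> {1..2}"
      using e(1) by (auto simp: c_def d_def dist_real_def)
    then have "s \<in> F n"
      using e(2)[of s] by force
    then show "dil \<rho> s \<le> real n"
      using class_B_pos[OF assms] by (intro dil_le) (auto simp: F_def)
  qed
qed

text \<open>Division by c moves the good interval to [1, d/c] at the cost of the factor
  \<open>dil \<rho> (1 / c)\<close>. Powers of d/c > 1 then exhaust [1,2], and the factor
  \<open>dil \<rho> (1/2)\<close> carries the bound to [1/2,1]. The lower half serves the comparison
  of integral and dyadic sum, the upper half the rounding of the norm quotient.\<close>

lemma dil_locally_bounded:
  assumes "class_B \<rho>"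
  obtains K where "1 \<le> K" "\<And>s. s \<in> {1/2..2} \<Longrightarrow> dil \<rho> s \<le> K"
proof -
  obtain c d K0 where cd: "1 \<le> c" "c < d" "\<And>s. s \<in> {c..d} \<Longrightarrow> dil \<rho> s \<le> K0"
    using dil_bounded_on_interval[OF assms] by blast
  \<comment> \<open>The maximum with 1 makes the powers of K increase, so that the bound at one
    stage also covers the points reached at earlier stages.\<close>
  define g K where "g = d / c" and "K = max 1 (K0 * dil \<rho> (1 / c))"
  have g: "1 < g" and K: "1 \<le> K"
    using cd by (auto simp: g_def K_def)
  have near: "dil \<rho> s \<le> K" if "s \<in> {1..g}" for s
  proof -
    have "dil \<rho> ((s * c) * (1 / c)) \<le> dil \<rho> (s * c) * dil \<rho> (1 / c)"
      using that cd by (intro dil_mult_le assms) auto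
    also have "\<dots> \<le> K0 * dil \<rho> (1 / c)"
      using that cd dil_pos[OF assms, of "1 / c"]
      by (intro mult_right_mono cd) (auto simp: g_def field_simps)
    finally show ?thesis
      using cd by (simp add: K_def)
  qed
  have power: "\<forall>s\<in>{1..g ^ j}. dil \<rho> s \<le> K ^ j" for j
  proof (induction j)
    case 0
    then show ?case using dil_one[OF assms] by simp
  next
    case (Suc j)
    show ?case
    proof
      fix s assume s: "s \<in> {1..g ^ Suc j}"
      show "dil \<rho> s \<le> K ^ Suc j"
      proof (cases "s \<le> g")
        case True
        moreover have "K * 1 \<le> K * K ^ j"
          using K by (intro mult_left_mono one_le_power) auto
        ultimately show ?thesis
          using near[of s] s by auto
      next
        case False
        then have "s / g \<in> {1..g ^ j}"
          using s g by (auto simp: field_simps)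
        moreover have "dil \<rho> (g * (s / g)) \<le> dil \<rho> g * dil \<rho> (s / g)"
          using g s by (intro dil_mult_le assms) auto
        moreover have "dil \<rho> g * dil \<rho> (s / g) \<le> K * K ^ j"
          using calculation(1) Suc near[of g] g K dil_pos[OF assms, of "s / g"] s
          by (intro mult_mono) auto
        ultimately show ?thesis
          using g by simp
      qed
    qed
  qed
  obtain j where j: "2 < g ^ j"
    using real_arch_pow[OF g] by blast
  have up: "dil \<rho> s \<le> K ^ j" if "s \<in> {1..2}" for s
    using power[of j] j that by auto
  have half: "0 < dil \<rho> (1/2)"
    using assms by (rule dil_pos) simp
  show ?thesis
  proof (rule that[of "max 1 (dil \<rho> (1/2)) * K ^ j"])
    have "1 * 1 \<le> max 1 (dil \<rho> (1/2)) * K ^ j"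
      using K by (intro mult_mono one_le_power) auto
    then show "1 \<le> max 1 (dil \<rho> (1/2)) * K ^ j" by simp
    fix s :: real assume s: "s \<in> {1/2..2}"
    show "dil \<rho> s \<le> max 1 (dil \<rho> (1/2)) * K ^ j"
    proof (cases "1 \<le> s")
      case True
      then have "1 * dil \<rho> s \<le> max 1 (dil \<rho> (1/2)) * K ^ j"
        using s up dil_pos[OF assms, of s] by (intro mult_mono) auto
      then show ?thesis by simp
    next
      case False
      have "dil \<rho> ((1/2) * (2 * s)) \<le> dil \<rho> (1/2) * dil \<rho> (2 * s)"
        using s by (intro dil_mult_le assms) auto
      also have "\<dots> \<le> max 1 (dil \<rho> (1/2)) * K ^ j"
        using s False up dil_pos[OF assms, of "2 * s"] by (intro mult_mono) auto
      finally show ?thesis by simp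
    qed
  qed
qed

section \<open>The integrability condition in dyadic form\<close>

text \<open>On a dyadic interval [a, 2a) the quotient a/t lies in (1/2, 1], so submultiplicativity
  gives \<open>dil \<rho> a \<le> K * dil \<rho> t\<close>. The factors min(1, 1/t) and 1/t lose at
  most 2 each; together this is the 4K.\<close>

lemma dil_integral_dyadic_lower_bound:
  assumes "class_B \<rho>" and K: "1 \<le> K" "\<And>s. s \<in> {1/2..2} \<Longrightarrow> dil \<rho> s \<le> K"
    and t: "t \<in> {2 powi k..<2 powi (k + 1)}"
  shows "min 1 (2 powi (- k)) * dil \<rho> (2 powi k) * 2 powi (- k) / (4 * K)
         \<le> min 1 (1 / t) * dil \<rho> t / t"
proof -
  define a :: real where "a = 2 powi k"
  have a: "0 < a" and t: "a \<le> t" "t < 2 * a"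
    using t by (auto simp: a_def power_int_add)
  have m: "2 powi (- k) = 1 / a"
    by (simp add: a_def power_int_minus field_simps)
  have "dil \<rho> (a / t * t) \<le> dil \<rho> (a / t) * dil \<rho> t"
    using a t by (intro dil_mult_le assms) auto
  also have "\<dots> \<le> K * dil \<rho> t"
    using a t dil_pos[OF assms(1), of t] by (intro mult_right_mono K) (auto simp: field_simps)
  finally have 1: "dil \<rho> a / K \<le> dil \<rho> t"
    using a t K by (simp add: field_simps)
  have 2: "min 1 (1 / a) / 2 \<le> min 1 (1 / t)" "1 / a / 2 \<le> 1 / t"
    using a t by (auto simp: field_simps min_def)
  have "(min 1 (1 / a) / 2) * (dil \<rho> a / K) * (1 / a / 2) \<le> min 1 (1 / t) * dil \<rho> t * (1 / t)"
    using a t K dil_pos[OF assms(1), of t] dil_pos[OF assms(1), of a]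
    by (intro mult_mono 1 2) auto
  then show ?thesis
    by (simp add: m a_def[symmetric] ac_simps)
qed

text \<open>Finite sums are integrals of step functions below the integrand, since the dyadic
  intervals are disjoint and the factor \<open>2 powi (- k)\<close> coming from 1/t cancels the
  length of the k-th interval. The sum obtained is the one that dominates the series of a
  representation in the sum space.\<close>

lemma summable_dil_dyadic:
  assumes "class_Bpm \<rho>"
  shows "(\<lambda>k::int. min 1 (2 powi (- k)) * dil \<rho> (2 powi k)) summable_on UNIV"
proof -
  have B: "class_B \<rho>" and fin: "dil_integral \<rho> < \<infinity>"
    using assms by (auto simp: class_Bpm_def)
  obtain K where K: "1 \<le> K" "\<And>s. s \<in> {1/2..2} \<Longrightarrow> dil \<rho> s \<le> K"
    using dil_locally_bounded[OF B] by blast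
  define I where "I k = {2 powi k..<(2::real) powi (k + 1)}" for k :: int
  define h where "h k = min 1 (2 powi (- k)) * dil \<rho> (2 powi k)" for k :: int
  have h: "0 \<le> h k" for k
    using dil_pos[OF B, of "2 powi k"] by (simp add: h_def)
  have disj: "I k \<inter> I l = {}" if "k \<noteq> l" for k l
  proof -
    have "I k \<inter> I l = {}" if "k < l" for k l
    proof -
      have "(2::real) powi (k + 1) \<le> 2 powi l"
        using that by (intro power_int_increasing) auto
      then show ?thesis by (auto simp: I_def)
    qed
    then show ?thesis
      using that by (metis Int_commute linorder_less_linear)
  qed
  show ?thesis
    unfolding h_def[symmetric]
  proof (rule nonneg_bdd_above_summable_on)
    show "bdd_above (sum h ` {F. F \<subseteq> UNIV \<and> finite F})"
    proof (rule bdd_aboveI, clarify)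
      fix F :: "int set" assume F: "finite F"
      have len: "2 powi (k + 1) - 2 powi k = (2::real) powi k" for k :: int
        by (simp add: power_int_add)
      have "ennreal (sum h F / (4 * K)) = (\<Sum>k\<in>F. ennreal (h k * 2 powi (- k) / (4 * K)) * emeasure lborel (I k))"
      proof -
        have "ennreal (h k * 2 powi (- k) / (4 * K)) * emeasure lborel (I k) = ennreal (h k / (4 * K))" for k
        proof -
          have "emeasure lborel (I k) = ennreal (2 powi k)"
            unfolding I_def by (subst emeasure_lborel_Ico) (auto simp: len intro!: power_int_increasing)
          then show ?thesis
            using h[of k] K by (simp add: ennreal_mult[symmetric] power_int_minus)
        qed
        then show ?thesis
          using h K by (simp add: sum_divide_distrib sum_ennreal)
      qed
      also have "\<dots> = (\<integral>\<^sup>+t. (\<Sum>k\<in>F. ennreal (h k * 2 powi (- k) / (4 * K)) * indicator (I k) t) \<partial>lborel)"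
        by (subst nn_integral_sum) (auto simp: I_def nn_integral_cmult_indicator)
      also have "\<dots> \<le> dil_integral \<rho>"
        unfolding dil_integral_def
      proof (rule nn_integral_mono)
        fix t :: real
        show "(\<Sum>k\<in>F. ennreal (h k * 2 powi (- k) / (4 * K)) * indicator (I k) t)
              \<le> ennreal (min 1 (1 / t) * dil \<rho> t / t) * indicator {0<..} t"
        proof (cases "\<exists>k\<in>F. t \<in> I k")
          case True
          then obtain k where k: "k \<in> F" "t \<in> I k" by blast
          then have "t \<notin> I l" if "l \<noteq> k" for l
            using disj[OF that] by auto
          then have "(\<Sum>l\<in>F. ennreal (h l * 2 powi (- l) / (4 * K)) * indicator (I l) t)
              = (\<Sum>l\<in>F. if l = k then ennreal (h k * 2 powi (- k) / (4 * K)) else 0)"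
            using k by (intro sum.cong) (auto simp: indicator_def)
          also have "\<dots> = ennreal (h k * 2 powi (- k) / (4 * K))"
            using F k by simp
          also have "\<dots> \<le> ennreal (min 1 (1 / t) * dil \<rho> t / t)"
            using dil_integral_dyadic_lower_bound[OF B K, of t k] k
            by (intro ennreal_leI) (auto simp: h_def I_def)
          also have "\<dots> = \<dots> * indicator {0<..} t"
          proof -
            have "(0::real) < 2 powi k" by simp
            also have "\<dots> \<le> t" using k by (simp add: I_def)
            finally have "0 < t" .
            then show ?thesis by simp
          qed
          finally show ?thesis .
        qed (simp add: indicator_def)
      qed
      finally have "ennreal (sum h F / (4 * K)) \<le> ennreal (enn2real (dil_integral \<rho>))"
        using fin by simp
      then have "sum h F / (4 * K) \<le> enn2real (dil_integral \<rho>)"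
        by (simp add: ennreal_le_iff)
      then show "sum h F \<le> 4 * K * enn2real (dil_integral \<rho>)"
        using K by (simp add: field_simps)
    qed
  qed (use h in auto)
qed

section \<open>The dual parameter \<gamma>\<close>

text \<open>Everything follows from
  \<open>dil \<rho> (1/t) \<le> dil \<rho> s * dil \<rho> (1/(s*t))\<close>: taking inverses shows
  that \<gamma> grows under dilation by s by at most \<open>dil \<rho> s\<close>. The case t = 1
  bounds \<gamma> itself, which later puts \<rho> and \<gamma> under the same summable
  majorant.\<close>

lemma
  fixes \<rho> \<gamma> :: "real \<Rightarrow> real"
  assumes B: "class_B \<rho>" and \<gamma>: "\<And>t. t > 0 \<Longrightarrow> \<gamma> t = inverse (dil \<rho> (inverse t))"
  shows dual_parameter_pos: "0 < t \<Longrightarrow> 0 < \<gamma> t"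
    and dual_parameter_one: "\<gamma> 1 = 1"
    and dual_parameter_dil: "0 < s \<Longrightarrow> dil_finite \<gamma> s \<and> dil \<gamma> s \<le> dil \<rho> s"
    and dual_parameter_le_dil: "0 < t \<Longrightarrow> \<gamma> t \<le> dil \<rho> t"
proof -
  show pos: "0 < \<gamma> t" if "0 < t" for t
    using dil_pos[OF B, of "inverse t"] that \<gamma> by simp
  show one: "\<gamma> 1 = 1"
    using \<gamma> dil_one[OF B] by simp
  have mult: "\<gamma> (s * t) \<le> dil \<rho> s * \<gamma> t" if "0 < s" "0 < t" for s t
  proof -
    have "dil \<rho> (s * inverse (s * t)) \<le> dil \<rho> s * dil \<rho> (inverse (s * t))"
      using that by (intro dil_mult_le B) auto
    moreover have "s * inverse (s * t) = inverse t"
      using that by (simp add: field_simps)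
    moreover have "0 < dil \<rho> (inverse t)" "0 < dil \<rho> (inverse (s * t))"
      using that by (auto intro!: dil_pos[OF B])
    moreover have "inverse b \<le> c * inverse a" if "a \<le> c * b" "0 < a" "0 < b" for a b c :: real
      using that by (simp add: field_simps)
    ultimately have "inverse (dil \<rho> (inverse (s * t))) \<le> dil \<rho> s * inverse (dil \<rho> (inverse t))"
      by metis
    then show ?thesis
      using that \<gamma>[of t] \<gamma>[of "s * t"] by simp
  qed
  show "dil_finite \<gamma> s \<and> dil \<gamma> s \<le> dil \<rho> s" if "0 < s"
    using dil_le[of \<gamma> s "dil \<rho> s"] pos mult that by simp
  show "\<gamma> t \<le> dil \<rho> t" if "0 < t"
    using mult[of t 1] that one by simp
qed

lemma dual_parameter_dil_integral:
  assumes B: "class_B \<rho>" and \<gamma>: "\<And>t. t > 0 \<Longrightarrow> \<gamma> t = inverse (dil \<rho> (inverse t))"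
  shows "dil_integral \<gamma> \<le> dil_integral \<rho>"
  unfolding dil_integral_def
proof (rule nn_integral_mono)
  fix t :: real
  show "ennreal (min 1 (1 / t) * dil \<gamma> t / t) * indicator {0<..} t
      \<le> ennreal (min 1 (1 / t) * dil \<rho> t / t) * indicator {0<..} t"
    using dual_parameter_dil[OF B \<gamma>, of t]
    by (auto simp: indicator_def intro!: ennreal_leI divide_right_mono mult_left_mono)
qed

section \<open>Young's inequality for sequences\<close>

text \<open>With m the weighted arithmetic mean, \<open>ln s \<le> s - 1\<close> is applied to x/m,
  y/m and z/m; the weighted sum of the right-hand sides is zero.\<close>

lemma weighted_mean_three:
  fixes x y z :: real
  assumes "0 < x" "0 < y" "0 < z" "0 \<le> \<alpha>" "0 \<le> \<beta>" "0 \<le> \<delta>" "\<alpha> + \<beta> + \<delta> = 1"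
  shows "x powr \<alpha> * y powr \<beta> * z powr \<delta> \<le> \<alpha> * x + \<beta> * y + \<delta> * z"
proof -
  define m where "m = \<alpha> * x + \<beta> * y + \<delta> * z"
  have m: "0 < m"
  proof -
    have "min x (min y z) = \<alpha> * min x (min y z) + \<beta> * min x (min y z) + \<delta> * min x (min y z)"
      using assms(7) by (simp flip: distrib_right)
    also have "\<dots> \<le> m"
      unfolding m_def using assms by (intro add_mono mult_left_mono) auto
    finally show ?thesis using assms by simp
  qed
  have "\<alpha> * ln (x / m) + \<beta> * ln (y / m) + \<delta> * ln (z / m)
      \<le> \<alpha> * (x / m - 1) + \<beta> * (y / m - 1) + \<delta> * (z / m - 1)"
    using assms m by (intro add_mono mult_left_mono ln_le_minus_one) auto
  also have "\<dots> = (\<alpha> * x + \<beta> * y + \<delta> * z) / m - (\<alpha> + \<beta> + \<delta>)"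
    by (simp add: field_simps add_divide_distrib)
  also have "\<dots> = 0"
    using m assms by (simp add: m_def)
  finally have "\<alpha> * ln x + \<beta> * ln y + \<delta> * ln z \<le> (\<alpha> + \<beta> + \<delta>) * ln m"
    using assms(1-3) m by (simp add: ln_div algebra_simps)
  then have "\<alpha> * ln x + \<beta> * ln y + \<delta> * ln z \<le> ln m"
    using assms(7) by simp
  then have "exp (\<alpha> * ln x + \<beta> * ln y + \<delta> * ln z) \<le> exp (ln m)"
    by simp
  then show ?thesis
    using assms m by (simp add: powr_def exp_add m_def)
qed

text \<open>The odd exponents come from Hoelder's inequality for \<open>(A B)\<^sup>\<alpha> A\<^sup>\<beta> B\<^sup>\<delta>\<close>.\<close>

lemma holder_three:
  fixes A B :: "'i \<Rightarrow> real"
  assumes nn: "\<And>k. 0 \<le> A k" "\<And>k. 0 \<le> B k"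
    and sA: "A summable_on UNIV" "infsum A UNIV \<le> 1"
    and sB: "B summable_on UNIV" "infsum B UNIV \<le> 1"
    and e: "0 \<le> \<alpha>" "0 \<le> \<beta>" "0 \<le> \<delta>" "\<alpha> + \<beta> + \<delta> = 1"
  shows "(\<lambda>k. A k powr (\<alpha> + \<beta>) * B k powr (\<alpha> + \<delta>)) summable_on UNIV"
    and "(\<Sum>\<^sub>\<infinity>k. A k powr (\<alpha> + \<beta>) * B k powr (\<alpha> + \<delta>)) \<le> (\<Sum>\<^sub>\<infinity>k. A k * B k) powr \<alpha>"
    and "(\<lambda>k. A k * B k) summable_on UNIV"
proof -
  have B1: "B k \<le> 1" for k
    using finite_sum_le_infsum[OF sB(1), of "{k}"] nn sB(2) by simp
  show sAB: "(\<lambda>k. A k * B k) summable_on UNIV"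
    by (rule summable_on_comparison_test[OF sA(1)]) (use nn B1 in \<open>auto intro: mult_left_le\<close>)
  define d where "d = (\<Sum>\<^sub>\<infinity>k. A k * B k)"
  have d: "0 \<le> d"
    unfolding d_def using nn by (intro infsum_nonneg) auto
  \<comment> \<open>This is the weighted mean inequality for AB/d, A and B, scaled back by
    \<open>d powr \<alpha>\<close>. Dividing by the total d makes all three sequences have sum at
    most 1, so M sums to at most \<open>d powr \<alpha>\<close>.\<close>
  define M where "M k = d powr \<alpha> * (\<alpha> / d * (A k * B k) + \<beta> * A k + \<delta> * B k)" for k
  have M: "M summable_on UNIV"
    unfolding M_def by (intro summable_on_cmult_right summable_on_add sA sB sAB)
  have le: "A k powr (\<alpha> + \<beta>) * B k powr (\<alpha> + \<delta>) \<le> M k" for k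
  proof (cases "A k = 0 \<or> B k = 0")
    \<comment> \<open>\<open>0 powr x\<close> is 0 even for x = 0, so the left side vanishes; if d =
      0, division by d yields 0 and \<open>M k\<close> is still nonnegative.\<close>
    case True
    then show ?thesis
      using nn[of k] d e by (auto simp: M_def)
  next
    case False
    then have pos: "0 < A k" "0 < B k"
      using nn[of k] by auto
    have "A k * B k \<le> d"
      using finite_sum_le_infsum[OF sAB, of "{k}"] nn by (simp add: d_def)
    then have dp: "0 < d"
      using pos mult_pos_pos[OF pos] by linarith
    have "A k powr (\<alpha> + \<beta>) * B k powr (\<alpha> + \<delta>)
        = d powr \<alpha> * ((A k * B k / d) powr \<alpha> * A k powr \<beta> * B k powr \<delta>)"
      using pos dp by (simp add: powr_mult powr_divide powr_add)
    also have "\<dots> \<le> M k"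
      unfolding M_def using weighted_mean_three[of "A k * B k / d" "A k" "B k" \<alpha> \<beta> \<delta>] pos dp e
      by (intro mult_left_mono) auto
    finally show ?thesis .
  qed
  show s: "(\<lambda>k. A k powr (\<alpha> + \<beta>) * B k powr (\<alpha> + \<delta>)) summable_on UNIV"
    by (rule summable_on_comparison_test[OF M]) (use le in auto)
  have "(\<Sum>\<^sub>\<infinity>k. A k powr (\<alpha> + \<beta>) * B k powr (\<alpha> + \<delta>)) \<le> infsum M UNIV"
    by (rule infsum_mono[OF s M le])
  also have "\<dots> = d powr \<alpha> * (\<alpha> / d * d + \<beta> * infsum A UNIV + \<delta> * infsum B UNIV)"
    unfolding M_def
    by (intro infsumI has_sum_cmult_right has_sum_add has_sum_infsum sA sB sAB[folded d_def]
        has_sum_infsum[OF sAB, folded d_def])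
  also have "\<dots> \<le> d powr \<alpha> * (\<alpha> * 1 + \<beta> * 1 + \<delta> * 1)"
    using e sA sB by (intro mult_left_mono add_mono) (auto simp: mult_left_le)
  also have "\<dots> = d powr \<alpha>"
    using e by simp
  finally show "(\<Sum>\<^sub>\<infinity>k. A k powr (\<alpha> + \<beta>) * B k powr (\<alpha> + \<delta>)) \<le> (\<Sum>\<^sub>\<infinity>k. A k * B k) powr \<alpha>"
    by (simp add: d_def)
qed


text \<open>Only an inequality is claimed because a vanishing total makes every quotient 0.\<close>

lemma infsum_normalized:
  fixes f :: "'i \<Rightarrow> real"
  assumes "f summable_on A"
  shows "(\<lambda>k. f k / infsum f A) summable_on A" "(\<Sum>\<^sub>\<infinity>k\<in>A. f k / infsum f A) \<le> 1"
proof -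
  show "(\<lambda>k. f k / infsum f A) summable_on A"
    unfolding divide_inverse by (rule summable_on_cmult_left[OF assms])
  have "x * inverse x \<le> 1" for x :: real
    by (cases "x = 0") auto
  then show "(\<Sum>\<^sub>\<infinity>k\<in>A. f k / infsum f A) \<le> 1"
    by (simp add: divide_inverse infsum_cmult_left')
qed

text \<open>Hoelder's inequality for the normalized powers A and the reflection of B, with weights
  1/p + 1/q - 1, 1 - 1/q and 1 - 1/p, which are nonnegative and add up to 1. The factor with
  exponent 1/p + 1/q - 1 = 1/r is kept rather than estimated: raised to the power r it can be summed
  over n.\<close>

lemma young_pointwise:
  fixes a b :: "int \<Rightarrow> real" and p q :: real
  assumes nn: "\<And>k. 0 \<le> a k" "\<And>k. 0 \<le> b k" and pq: "1 \<le> p" "1 \<le> q" "1 \<le> 1 / p + 1 / q"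
    and sa: "(\<lambda>k. a k powr p) summable_on UNIV" and sb: "(\<lambda>k. b k powr q) summable_on UNIV"
  defines "A \<equiv> \<lambda>k. a k powr p / (\<Sum>\<^sub>\<infinity>k. a k powr p)" and "B \<equiv> \<lambda>k. b k powr q / (\<Sum>\<^sub>\<infinity>k. b k powr q)"
  shows "(\<lambda>k. a k * b (n - k)) summable_on UNIV"
    and "(\<lambda>k. A k * B (n - k)) summable_on UNIV"
    and "(\<Sum>\<^sub>\<infinity>k. a k * b (n - k))
         \<le> (\<Sum>\<^sub>\<infinity>k. a k powr p) powr (1 / p) * (\<Sum>\<^sub>\<infinity>k. b k powr q) powr (1 / q)
           * (\<Sum>\<^sub>\<infinity>k. A k * B (n - k)) powr (1 / p + 1 / q - 1)"
proof -
  have scaled: "f k = (\<Sum>\<^sub>\<infinity>k. f k powr s) powr (1 / s) * (f k powr s / (\<Sum>\<^sub>\<infinity>k. f k powr s)) powr (1 / s)"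
    if "\<And>k. 0 \<le> f k" "1 \<le> s" "(\<lambda>k. f k powr s) summable_on UNIV" for f :: "int \<Rightarrow> real" and s k
  proof (cases "(\<Sum>\<^sub>\<infinity>k. f k powr s) = 0")
    case True
    have "f k powr s = 0"
      by (rule nonneg_infsum_le_0D[of "\<lambda>k. f k powr s" UNIV]) (use True that in auto)
    then show ?thesis by simp
  next
    case False
    moreover have "0 \<le> (\<Sum>\<^sub>\<infinity>k. f k powr s)"
      by (intro infsum_nonneg) auto
    ultimately show ?thesis
      using that by (simp add: powr_divide powr_powr)
  qed
  have AB0: "0 \<le> A k" "0 \<le> B k" for k
    by (auto simp: A_def B_def intro!: divide_nonneg_nonneg infsum_nonneg)
  have A1: "A summable_on UNIV" "infsum A UNIV \<le> 1"
    unfolding A_def by (rule infsum_normalized[OF sa])+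
  have bij: "bij (\<lambda>k. n - k)"
    by (rule bij_betw_byWitness[where f' = "\<lambda>k. n - k"]) auto
  have B1: "(\<lambda>k. B (n - k)) summable_on UNIV" "(\<Sum>\<^sub>\<infinity>k. B (n - k)) \<le> 1"
    using infsum_normalized[OF sb] summable_on_reindex_bij_betw[OF bij, of B] infsum_reindex_bij_betw[OF bij, of B]
    by (simp_all add: B_def)
  define Na Nb where "Na = (\<Sum>\<^sub>\<infinity>k. a k powr p) powr (1 / p)" and "Nb = (\<Sum>\<^sub>\<infinity>k. b k powr q) powr (1 / q)"
  have ab: "a k * b (n - k) = Na * Nb * (A k powr (1 / p) * B (n - k) powr (1 / q))" for k
    using scaled[of a p k, OF nn(1) pq(1) sa] scaled[of b q "n - k", OF nn(2) pq(2) sb]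
    by (simp add: Na_def Nb_def A_def B_def ac_simps)
  have exps: "1 / p + 1 / q - 1 + (1 - 1 / q) = 1 / p" "1 / p + 1 / q - 1 + (1 - 1 / p) = 1 / q"
    by auto
  note H = holder_three[OF AB0(1) AB0(2) A1 B1, of "1 / p + 1 / q - 1" "1 - 1 / q" "1 - 1 / p",
      unfolded exps]
  have H1: "(\<lambda>k. A k powr (1 / p) * B (n - k) powr (1 / q)) summable_on UNIV"
    and H2: "(\<Sum>\<^sub>\<infinity>k. A k powr (1 / p) * B (n - k) powr (1 / q))
      \<le> (\<Sum>\<^sub>\<infinity>k. A k * B (n - k)) powr (1 / p + 1 / q - 1)"
    and H3: "(\<lambda>k. A k * B (n - k)) summable_on UNIV"
    using pq by (auto intro!: H)
  show "(\<lambda>k. A k * B (n - k)) summable_on UNIV" by (rule H3)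
  show "(\<lambda>k. a k * b (n - k)) summable_on UNIV"
    unfolding ab by (rule summable_on_cmult_right[OF H1])
  show "(\<Sum>\<^sub>\<infinity>k. a k * b (n - k)) \<le> (\<Sum>\<^sub>\<infinity>k. a k powr p) powr (1 / p) * (\<Sum>\<^sub>\<infinity>k. b k powr q) powr (1 / q)
           * (\<Sum>\<^sub>\<infinity>k. A k * B (n - k)) powr (1 / p + 1 / q - 1)"
    unfolding ab infsum_cmult_right' Na_def[symmetric] Nb_def[symmetric]
    by (intro mult_left_mono H2) (simp add: Na_def Nb_def)
qed

section \<open>Sequence norms and convolution\<close>

lemma ell_norm_nonneg: "in_ell s a \<Longrightarrow> 0 \<le> ell_norm s a"
  by (cases "s = \<infinity>") (auto simp: ell_norm_def in_ell_def intro: cSUP_upper2)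

lemma abs_le_ell_norm:
  assumes "in_ell s a" "0 < s"
  shows "\<bar>a n\<bar> \<le> ell_norm s a"
proof (cases s)
  case (real s')
  have "\<bar>a n\<bar> powr s' \<le> (\<Sum>\<^sub>\<infinity>n. \<bar>a n\<bar> powr s')"
    using assms real finite_sum_le_infsum[of "\<lambda>n. \<bar>a n\<bar> powr s'" UNIV "{n}"] by (simp add: in_ell_def)
  then have "(\<bar>a n\<bar> powr s') powr (1 / s') \<le> (\<Sum>\<^sub>\<infinity>n. \<bar>a n\<bar> powr s') powr (1 / s')"
    using assms real by (intro powr_mono2) auto
  then show ?thesis
    using assms real by (simp add: ell_norm_def powr_powr)
qed (use assms in \<open>auto simp: in_ell_def ell_norm_def intro: cSUP_upper\<close>)

lemma in_ell_infinity_bound: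
  assumes "\<And>n. \<bar>c n\<bar> \<le> K"
  shows "in_ell \<infinity> c" "ell_norm \<infinity> c \<le> K"
  using assms by (auto simp: in_ell_def ell_norm_def intro!: bdd_aboveI cSUP_least)

lemma in_ell_finite_sums_bound:
  assumes "0 < s" "0 \<le> K" "\<And>F. finite F \<Longrightarrow> (\<Sum>n\<in>F. \<bar>c n\<bar> powr s) \<le> K powr s"
  shows "in_ell (ereal s) c" "ell_norm (ereal s) c \<le> K"
proof -
  have summable: "(\<lambda>n. \<bar>c n\<bar> powr s) summable_on UNIV"
    using assms(3) by (intro nonneg_bdd_above_summable_on bdd_aboveI) auto
  then show "in_ell (ereal s) c" by (simp add: in_ell_def)
  have "(\<Sum>\<^sub>\<infinity>n. \<bar>c n\<bar> powr s) \<le> K powr s"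
    using assms(3) by (intro infsum_le_finite_sums summable) auto
  then have "(\<Sum>\<^sub>\<infinity>n. \<bar>c n\<bar> powr s) powr (1 / s) \<le> (K powr s) powr (1 / s)"
    using assms by (intro powr_mono2 infsum_nonneg) auto
  then show "ell_norm (ereal s) c \<le> K"
    using assms by (simp add: ell_norm_def powr_powr)
qed

text \<open>Domination combined with translation invariance of the sequence norm; the shift m will
  be the rounded logarithm of the quotient of the operator norms.\<close>

lemma ell_norm_mono_shift:
  assumes s: "0 < s" and d: "in_ell s d" and K: "0 \<le> K" and le: "\<And>n. \<bar>c n\<bar> \<le> K * \<bar>d (n + m)\<bar>"
  shows "in_ell s c \<and> ell_norm s c \<le> K * ell_norm s d"
proof (cases s)
  case (real s')
  have s': "0 < s'" using s real by simp
  have d': "(\<lambda>n. \<bar>d n\<bar> powr s') summable_on UNIV"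
    using d real by (simp add: in_ell_def)
  have "(\<Sum>n\<in>F. \<bar>c n\<bar> powr s') \<le> (K * ell_norm s d) powr s'" if "finite F" for F
  proof -
    have "(\<Sum>n\<in>F. \<bar>c n\<bar> powr s') \<le> (\<Sum>n\<in>F. (K * \<bar>d (n + m)\<bar>) powr s')"
      using s' le by (intro sum_mono powr_mono2) auto
    also have "\<dots> = K powr s' * (\<Sum>n\<in>F. \<bar>d (n + m)\<bar> powr s')"
      using K by (simp add: powr_mult sum_distrib_left)
    also have "(\<Sum>n\<in>F. \<bar>d (n + m)\<bar> powr s') = (\<Sum>n\<in>(\<lambda>n. n + m) ` F. \<bar>d n\<bar> powr s')"
      by (subst sum.reindex) (auto simp: inj_on_def)
    also have "\<dots> \<le> (\<Sum>\<^sub>\<infinity>n. \<bar>d n\<bar> powr s')"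
      using that by (intro finite_sum_le_infsum d') auto
    also have "(\<Sum>\<^sub>\<infinity>n. \<bar>d n\<bar> powr s') = ell_norm s d powr s'"
      using s' real by (simp add: ell_norm_def powr_powr infsum_nonneg)
    finally show ?thesis
      using K ell_norm_nonneg[OF d] by (simp add: powr_mult mult_left_mono)
  qed
  then show ?thesis
    using in_ell_finite_sums_bound[OF s', of "K * ell_norm s d" c] K ell_norm_nonneg[OF d] real by simp
next
  case PInf
  have "\<bar>c n\<bar> \<le> K * ell_norm s d" for n
    using le[of n] mult_left_mono[OF abs_le_ell_norm[OF d s, of "n + m"] K] by linarith
  then show ?thesis
    using in_ell_infinity_bound[of c] PInf by blast
qed (use s in auto)

text \<open>An infinite p or q forces the other exponent to be 1 and r to be infinite, since 1/r
  cannot be negative. Two finite exponents leave the conjugate case, where r is infinite, and the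
  case of finite r.\<close>

lemma young_exponents:
  fixes p q r :: ereal
  assumes "1 \<le> p" "1 \<le> q" "0 < r" "1 / r = 1 / p + 1 / q - 1"
  obtains "p = \<infinity>" "q = 1" "r = \<infinity>" | "p = 1" "q = \<infinity>" "r = \<infinity>"
    | p' q' where "p = ereal p'" "q = ereal q'" "r = \<infinity>" "1 / p' + 1 / q' = 1"
    | p' q' r' where "p = ereal p'" "q = ereal q'" "r = ereal r'" "0 < r'" "1 / r' = 1 / p' + 1 / q' - 1"
proof -
  \<comment> \<open>This is 1/b = 1/a - 1 cleared of denominators: the left side is positive, the
    right side is not.\<close>
  have no: False if "b = a + a * b" "1 \<le> a" "0 < b" for a b :: real
  proof -
    have "1 * b \<le> a * b"
      using that by (intro mult_right_mono) auto
    then show False using that by linarith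
  qed
  show ?thesis
    by (cases p; cases q; cases r) (use assms that in \<open>auto simp: one_ereal_def field_simps\<close>, (metis no)+)
qed

lemma has_sum_finite_sum:
  fixes f :: "'j \<Rightarrow> 'i \<Rightarrow> real"
  assumes "finite F" "\<And>n. n \<in> F \<Longrightarrow> f n summable_on A"
  shows "((\<lambda>k. \<Sum>n\<in>F. f n k) has_sum (\<Sum>n\<in>F. infsum (f n) A)) A"
  using assms by (induction F) (auto intro!: has_sum_add has_sum_infsum)

text \<open>With an exponent pair (\<infinity>, 1) one factor is bounded by its supremum. For
  conjugate exponents the pointwise bound suffices. For finite r its r-th power is summed over n:
  the normalized sequences have sums at most 1, hence so does their convolution.\<close>

lemma young_ell:
  fixes p q r :: ereal
  assumes exps: "1 \<le> p" "1 \<le> q" "0 < r" "1 / r = 1 / p + 1 / q - 1"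
    and a: "in_ell p a" "\<And>k. 0 \<le> a k" and b: "in_ell q b" "\<And>k. 0 \<le> b k"
  shows "(\<lambda>k. a k * b (n - k)) summable_on UNIV"
    and "in_ell r (\<lambda>n. \<Sum>\<^sub>\<infinity>k. a k * b (n - k))"
    and "ell_norm r (\<lambda>n. \<Sum>\<^sub>\<infinity>k. a k * b (n - k)) \<le> ell_norm p a * ell_norm q b"
proof -
  define c where "c n = (\<Sum>\<^sub>\<infinity>k. a k * b (n - k))" for n
  have c0: "0 \<le> c n" for n
    unfolding c_def using a b by (intro infsum_nonneg) auto
  have bij: "bij (\<lambda>k. n - k)" for n :: int
    by (rule bij_betw_byWitness[where f' = "\<lambda>k. n - k"]) auto
  have "(\<forall>n. (\<lambda>k. a k * b (n - k)) summable_on UNIV) \<and> in_ell r c \<and> ell_norm r c \<le> ell_norm p a * ell_norm q b"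
    using exps
  proof (cases rule: young_exponents)
    case 1
    have sb: "b summable_on UNIV" "ell_norm q b = infsum b UNIV"
      using b 1 by (auto simp: in_ell_def ell_norm_def one_ereal_def infsum_nonneg)
    have sb': "(\<lambda>k. ell_norm p a * b (n - k)) summable_on UNIV" for n
      using summable_on_reindex_bij_betw[OF bij, of b n] sb by (intro summable_on_cmult_right) auto
    have le: "a k * b (n - k) \<le> ell_norm p a * b (n - k)" for n k
      using abs_le_ell_norm[OF a(1), of k] exps a b by (intro mult_right_mono) (auto simp: 1)
    have s: "(\<lambda>k. a k * b (n - k)) summable_on UNIV" for n
      by (rule summable_on_comparison_test[OF sb' le]) (use a b in auto)
    have "c n \<le> ell_norm p a * ell_norm q b" for n
    proof -
      have "c n \<le> (\<Sum>\<^sub>\<infinity>k. ell_norm p a * b (n - k))"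
        unfolding c_def by (intro infsum_mono s sb' le)
      then show ?thesis
        using infsum_reindex_bij_betw[OF bij, of b n] by (simp add: sb infsum_cmult_right')
    qed
    then show ?thesis
      using s c0 in_ell_infinity_bound[of c "ell_norm p a * ell_norm q b"] 1 by auto
  next
    case 2
    have sa: "a summable_on UNIV" "ell_norm p a = infsum a UNIV"
      using a 2 by (auto simp: in_ell_def ell_norm_def one_ereal_def infsum_nonneg)
    have sa': "(\<lambda>k. a k * ell_norm q b) summable_on UNIV"
      using sa by (intro summable_on_cmult_left)
    have le: "a k * b (n - k) \<le> a k * ell_norm q b" for n k
      using abs_le_ell_norm[OF b(1), of "n - k"] exps a b by (intro mult_left_mono) (auto simp: 2)
    have s: "(\<lambda>k. a k * b (n - k)) summable_on UNIV" for n
      by (rule summable_on_comparison_test[OF sa' le]) (use a b in auto)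
    have "c n \<le> ell_norm p a * ell_norm q b" for n
    proof -
      have "c n \<le> (\<Sum>\<^sub>\<infinity>k. a k * ell_norm q b)"
        unfolding c_def by (intro infsum_mono s sa' le)
      then show ?thesis
        by (simp add: sa infsum_cmult_left')
    qed
    then show ?thesis
      using s c0 in_ell_infinity_bound[of c "ell_norm p a * ell_norm q b"] 2 by auto
  next
    case (3 p' q')
    have pq: "1 \<le> p'" "1 \<le> q'" "1 \<le> 1 / p' + 1 / q'"
      using 3 exps by auto
    have "(\<lambda>k. a k powr p') summable_on UNIV" "(\<lambda>k. b k powr q') summable_on UNIV"
      using 3 a b by (auto simp: in_ell_def)
    note Y = young_pointwise[OF a(2) b(2) pq this]
    have "c n \<le> ell_norm p a * ell_norm q b" for n
    proof -
      \<comment> \<open>For conjugate exponents the remaining factor has exponent 0 and is 1, or 0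
        when its base is 0.\<close>
      have "x * y * z powr 0 \<le> x * y" if "0 \<le> x" "0 \<le> y" for x y z :: real
        using that by simp
      then show ?thesis
        using Y(3)[of n] 3 a b by (force simp: c_def ell_norm_def intro: order_trans)
    qed
    then show ?thesis
      using Y(1) c0 in_ell_infinity_bound[of c "ell_norm p a * ell_norm q b"] 3 by auto
  next
    case (4 p' q' r')
    have pq: "1 \<le> p'" "1 \<le> q'" "1 \<le> 1 / p' + 1 / q'"
    proof -
      have "0 < 1 / r'" using \<open>0 < r'\<close> by simp
      then show "1 \<le> 1 / p' + 1 / q'"
        using 4(5) by linarith
    qed (use 4 exps in auto)
    have sums: "(\<lambda>k. a k powr p') summable_on UNIV" "(\<lambda>k. b k powr q') summable_on UNIV"
      using 4 a b by (auto simp: in_ell_def)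
    define A B where "A k = a k powr p' / (\<Sum>\<^sub>\<infinity>k. a k powr p')"
      and "B k = b k powr q' / (\<Sum>\<^sub>\<infinity>k. b k powr q')" for k
    note Y = young_pointwise[OF a(2) b(2) pq sums, folded A_def B_def]
    define N where "N = ell_norm p a * ell_norm q b"
    have N: "0 \<le> N"
      using a b by (simp add: N_def ell_norm_nonneg)
    have AB0: "0 \<le> A k" "0 \<le> B k" for k
      by (auto simp: A_def B_def intro!: divide_nonneg_nonneg infsum_nonneg)
    have A1: "A summable_on UNIV" "infsum A UNIV \<le> 1" and B1: "B summable_on UNIV" "infsum B UNIV \<le> 1"
      using infsum_normalized[OF sums(1)] infsum_normalized[OF sums(2)]
      by (simp_all add: A_def[abs_def] B_def[abs_def])
    have c: "c n powr r' \<le> N powr r' * (\<Sum>\<^sub>\<infinity>k. A k * B (n - k))" for n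
    proof -
      have "c n \<le> N * (\<Sum>\<^sub>\<infinity>k. A k * B (n - k)) powr (1 / r')"
        using Y(3)[of n] 4 a b by (simp add: c_def N_def ell_norm_def)
      then have "c n powr r' \<le> (N * (\<Sum>\<^sub>\<infinity>k. A k * B (n - k)) powr (1 / r')) powr r'"
        using c0 4 by (intro powr_mono2) auto
      also have "\<dots> = N powr r' * (\<Sum>\<^sub>\<infinity>k. A k * B (n - k))"
        using N \<open>0 < r'\<close> AB0 by (simp add: powr_mult powr_powr infsum_nonneg)
      finally show ?thesis .
    qed
    \<comment> \<open>Restriction to finitely many n reduces the interchange of summations to adding
      finitely many series; the bound is uniform in F.\<close>
    have "(\<Sum>n\<in>F. \<bar>c n\<bar> powr r') \<le> N powr r'" if F: "finite F" for F
    proof -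
      have swap: "((\<lambda>k. \<Sum>n\<in>F. A k * B (n - k)) has_sum (\<Sum>n\<in>F. \<Sum>\<^sub>\<infinity>k. A k * B (n - k))) UNIV"
        using F Y(2) by (rule has_sum_finite_sum)
      have "(\<Sum>n\<in>F. \<bar>c n\<bar> powr r') \<le> (\<Sum>n\<in>F. N powr r' * (\<Sum>\<^sub>\<infinity>k. A k * B (n - k)))"
        using c c0 by (intro sum_mono) simp
      also have "\<dots> = N powr r' * (\<Sum>\<^sub>\<infinity>k. \<Sum>n\<in>F. A k * B (n - k))"
        by (simp add: infsumI[OF swap] sum_distrib_left)
      also have "\<dots> \<le> N powr r' * 1"
      proof (intro mult_left_mono)
        have "(\<lambda>k. \<Sum>n\<in>F. A k * B (n - k)) summable_on UNIV"
          using swap by (rule has_sum_imp_summable)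
        moreover have "(\<Sum>n\<in>F. A k * B (n - k)) \<le> A k" for k
        proof -
          have "(\<Sum>n\<in>F. B (n - k)) = (\<Sum>n\<in>(\<lambda>n. n - k) ` F. B n)"
            by (subst sum.reindex) (auto simp: inj_on_def)
          also have "\<dots> \<le> infsum B UNIV"
            using F AB0 by (intro finite_sum_le_infsum B1) auto
          finally show ?thesis
            using AB0[of k] B1(2) by (simp add: mult_left_le flip: sum_distrib_left)
        qed
        ultimately have "(\<Sum>\<^sub>\<infinity>k. \<Sum>n\<in>F. A k * B (n - k)) \<le> infsum A UNIV"
          using A1 by (intro infsum_mono) auto
        then show "(\<Sum>\<^sub>\<infinity>k. \<Sum>n\<in>F. A k * B (n - k)) \<le> 1"
          using A1 by linarith
      qed auto
      finally show ?thesis by simp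
    qed
    then show ?thesis
      using in_ell_finite_sums_bound[OF \<open>0 < r'\<close> N] Y(1) 4 by (simp add: N_def)
  qed
  then show "(\<lambda>k. a k * b (n - k)) summable_on UNIV" "in_ell r (\<lambda>n. \<Sum>\<^sub>\<infinity>k. a k * b (n - k))"
    "ell_norm r (\<lambda>n. \<Sum>\<^sub>\<infinity>k. a k * b (n - k)) \<le> ell_norm p a * ell_norm q b"
    by (simp_all add: c_def[abs_def])
qed

section \<open>Seminormed subspaces\<close>

text \<open>Definiteness is left out so that the sum space fits directly: there it would depend on
  the compatibility of the two norms of the couple.\<close>

locale seminormed =
  fixes X :: "'v::real_vector nspace"
  assumes subspace_pts: "subspace (pts X)"
    and nrm_nonneg: "x \<in> pts X \<Longrightarrow> 0 \<le> nrm X x"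
    and nrm_scale: "x \<in> pts X \<Longrightarrow> nrm X (c *\<^sub>R x) = \<bar>c\<bar> * nrm X x"
    and nrm_triangle: "x \<in> pts X \<Longrightarrow> y \<in> pts X \<Longrightarrow> nrm X (x + y) \<le> nrm X x + nrm X y"
begin

lemma zero_mem: "0 \<in> pts X"
  by (rule subspace_0[OF subspace_pts])

lemma add_mem: "x \<in> pts X \<Longrightarrow> y \<in> pts X \<Longrightarrow> x + y \<in> pts X"
  by (rule subspace_add[OF subspace_pts])

lemma diff_mem: "x \<in> pts X \<Longrightarrow> y \<in> pts X \<Longrightarrow> x - y \<in> pts X"
  by (rule subspace_diff[OF subspace_pts])

lemma scale_mem: "x \<in> pts X \<Longrightarrow> c *\<^sub>R x \<in> pts X"
  by (rule subspace_scale[OF subspace_pts])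

lemma sum_mem: "(\<And>i. i \<in> I \<Longrightarrow> z i \<in> pts X) \<Longrightarrow> sum z I \<in> pts X"
  by (rule subspace_sum[OF subspace_pts])

lemma nrm_zero: "nrm X 0 = 0"
  using nrm_scale[OF zero_mem, of 0] by simp

lemma nrm_minus: "x \<in> pts X \<Longrightarrow> nrm X (- x) = nrm X x"
  using nrm_scale[of x "-1"] by simp

lemma nrm_diff_commute: "x \<in> pts X \<Longrightarrow> y \<in> pts X \<Longrightarrow> nrm X (x - y) = nrm X (y - x)"
  using nrm_minus[OF diff_mem, of x y] by simp

lemma nrm_diff_triangle:
  assumes "x \<in> pts X" "y \<in> pts X" "z \<in> pts X"
  shows "nrm X (x - z) \<le> nrm X (x - y) + nrm X (y - z)"
  using nrm_triangle[of "x - y" "y - z"] assms by (simp add: diff_mem)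

lemma nrm_sum:
  assumes "\<And>i. i \<in> I \<Longrightarrow> z i \<in> pts X"
  shows "nrm X (sum z I) \<le> (\<Sum>i\<in>I. nrm X (z i))"
  using assms
proof (induction I rule: infinite_finite_induct)
  case (insert i I)
  then have "nrm X (z i + sum z I) \<le> nrm X (z i) + nrm X (sum z I)"
    by (intro nrm_triangle sum_mem) auto
  then show ?case
    using insert by simp
qed (auto simp: nrm_zero)

text \<open>A large symmetric interval contains F and its sum is close to w; what remains is a sum
  over indices outside F. The estimate turns convergence along symmetric intervals into a statement
  about arbitrary finite index sets, the form in which the regrouping of the double series uses
  it.\<close>

lemma nrm_diff_sum_le_tail:
  fixes z :: "int \<Rightarrow> 'v"
  assumes w: "w \<in> pts X" and z: "\<And>k. z k \<in> pts X"
    and summable: "(\<lambda>k. nrm X (z k)) summable_on UNIV"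
    and lim: "(\<lambda>N. nrm X (w - (\<Sum>k\<in>{- int N..int N}. z k))) \<longlonglongrightarrow> 0"
    and F: "finite F"
  shows "nrm X (w - sum z F) \<le> (\<Sum>\<^sub>\<infinity>k\<in>- F. nrm X (z k))"
proof (rule field_le_epsilon)
  fix e :: real assume "0 < e"
  obtain m where m: "F \<subseteq> {- int m..int m}"
  proof -
    have "k \<in> {- int (Max (nat ` abs ` F))..int (Max (nat ` abs ` F))}" if "k \<in> F" for k
    proof -
      have "nat \<bar>k\<bar> \<le> Max (nat ` abs ` F)"
        using F that by (intro Max_ge) auto
      then show ?thesis by auto
    qed
    then show ?thesis using that by blast
  qed
  have "eventually (\<lambda>N. nrm X (w - (\<Sum>k\<in>{- int N..int N}. z k)) < e \<and> m \<le> N) sequentially"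
    using lim \<open>0 < e\<close> by (intro eventually_conj eventually_ge_at_top order_tendstoD)
  then obtain N where N: "nrm X (w - (\<Sum>k\<in>{- int N..int N}. z k)) < e" "m \<le> N"
    by (auto simp: eventually_sequentially)
  define I where "I = {- int N..int N}"
  have FI: "F \<subseteq> I" "finite I"
    using m N by (auto simp: I_def)
  have "sum z I - sum z F = sum z (I - F)"
    using FI by (simp add: sum_diff)
  then have "nrm X (w - sum z F) \<le> nrm X (w - sum z I) + nrm X (sum z (I - F))"
    using nrm_diff_triangle[of w "sum z I" "sum z F"] w z by (simp add: sum_mem)
  also have "nrm X (sum z (I - F)) \<le> (\<Sum>k\<in>I - F. nrm X (z k))"
    using z by (intro nrm_sum)
  also have "\<dots> \<le> (\<Sum>\<^sub>\<infinity>k\<in>- F. nrm X (z k))"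
    using FI z summable_on_subset_banach[OF summable, of "- F"]
    by (intro finite_sum_le_infsum) (auto intro: nrm_nonneg)
  finally show "nrm X (w - sum z F) \<le> (\<Sum>\<^sub>\<infinity>k\<in>- F. nrm X (z k)) + e"
    using N by (simp add: I_def)
qed

end

lemma normed_space_seminormed: "normed_space X \<Longrightarrow> seminormed X"
  by (simp add: normed_space_def seminormed_def)

lemma normed_space_Metric_space:
  assumes "normed_space X"
  shows "Metric_space (pts X) (ndist X)"
proof -
  interpret seminormed X
    using assms by (rule normed_space_seminormed)
  show ?thesis
  proof
    fix x y z
    show "0 \<le> ndist X x y"
      by (simp add: ndist_def nrm_nonneg diff_mem)
    show "ndist X x y = ndist X y x"
      by (simp add: ndist_def nrm_diff_commute)
    show "ndist X x y = 0 \<longleftrightarrow> x = y" if "x \<in> pts X" "y \<in> pts X"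
      using that assms diff_mem[of x y] by (auto simp: ndist_def normed_space_def)
    show "ndist X x z \<le> ndist X x y + ndist X y z" if "x \<in> pts X" "y \<in> pts X" "z \<in> pts X"
      using that by (simp add: ndist_def nrm_diff_triangle)
  qed
qed

lemma banach_absolutely_convergent:
  fixes z :: "int \<Rightarrow> 'v::real_vector"
  assumes X: "banach_space X" and z: "\<And>k. z k \<in> pts X"
    and summable: "(\<lambda>k. nrm X (z k)) summable_on UNIV"
  obtains w where "w \<in> pts X" "(\<lambda>N. nrm X (w - (\<Sum>k\<in>{- int N..int N}. z k))) \<longlonglongrightarrow> 0"
proof -
  have nX: "normed_space X" and complete: "Metric_space.mcomplete (pts X) (ndist X)"
    using X by (auto simp: banach_space_def)
  interpret seminormed X
    using nX by (rule normed_space_seminormed)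
  interpret M: Metric_space "pts X" "ndist X"
    using nX by (rule normed_space_Metric_space)
  define I where "I N = {- int N..int N}" for N
  define s where "s N = sum z (I N)" for N
  define a where "a N = (\<Sum>k\<in>I N. nrm X (z k))" for N
  have mono: "I M \<subseteq> I N" if "M \<le> N" for M N
    using that by (auto simp: I_def)
  have s: "s N \<in> pts X" for N
    unfolding s_def using z by (rule sum_mem)
  have step: "nrm X (s N - s M) \<le> a N - a M" if "M \<le> N" for M N
  proof -
    have "s N - s M = sum z (I N - I M)" "a N - a M = (\<Sum>k\<in>I N - I M. nrm X (z k))"
      unfolding s_def a_def using mono[OF that] by (auto simp: sum_diff I_def)
    then show ?thesis
      using nrm_sum[of "I N - I M" z] z by simp
  qed
  have "convergent a"
  proof (rule Bseq_mono_convergent)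
    show "Bseq a"
    proof (rule BseqI')
      fix N
      show "norm (a N) \<le> (\<Sum>\<^sub>\<infinity>k. nrm X (z k))"
        using summable z finite_sum_le_infsum[OF summable, of "I N"]
        by (auto simp: a_def I_def sum_nonneg nrm_nonneg)
    qed
    show "\<forall>m n. m \<le> n \<longrightarrow> a m \<le> a n"
      unfolding a_def using mono z by (auto simp: I_def intro!: sum_mono2 nrm_nonneg)
  qed
  then have "Cauchy a"
    by (rule convergent_Cauchy)
  have "M.MCauchy s"
    unfolding M.MCauchy_def
  proof (intro conjI allI impI)
    show "range s \<subseteq> pts X" using s by auto
    fix e :: real assume "0 < e"
    then obtain N where N: "\<And>m n. N \<le> m \<Longrightarrow> N \<le> n \<Longrightarrow> dist (a m) (a n) < e"
      using \<open>Cauchy a\<close> by (metis Cauchy_def)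
    have "ndist X (s m) (s n) < e" if "N \<le> m" "N \<le> n" for m n
    proof (cases "m \<le> n")
      case True
      then have "nrm X (s m - s n) \<le> a n - a m"
        using step nrm_diff_commute[of "s m" "s n"] s by simp
      then show ?thesis
        using N[OF that] s by (simp add: ndist_def dist_real_def)
    next
      case False
      then have "nrm X (s m - s n) \<le> a m - a n"
        using step by simp
      then show ?thesis
        using N[OF that] s by (simp add: ndist_def dist_real_def)
    qed
    then show "\<exists>N. \<forall>n n'. N \<le> n \<longrightarrow> N \<le> n' \<longrightarrow> ndist X (s n) (s n') < e"
      by blast
  qed
  then obtain w where "limitin M.mtopology s w sequentially"
    using complete by (auto simp: M.mcomplete_def)
  then have w: "w \<in> pts X" and lim: "\<And>e. 0 < e \<Longrightarrow> eventually (\<lambda>N. ndist X (s N) w < e) sequentially"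
    by (auto simp: M.limitin_metric elim: eventually_mono)
  have "(\<lambda>N. nrm X (w - s N)) \<longlonglongrightarrow> 0"
  proof (rule tendstoI)
    fix e :: real assume "0 < e"
    then show "eventually (\<lambda>N. dist (nrm X (w - s N)) 0 < e) sequentially"
      using lim w s by (auto simp: ndist_def nrm_diff_commute nrm_nonneg diff_mem elim!: eventually_mono)
  qed
  then show ?thesis
    using that w by (simp add: s_def I_def)
qed

text \<open>Convergence in either norm implies convergence in the common topology, where the
  Hausdorff property identifies the limits. Here the compatibility of the two spaces of a couple
  enters.\<close>

lemma banach_couple_limit_unique:
  assumes couple: "banach_couple X0 X1"
    and s: "\<And>n. s n \<in> pts X0" "\<And>n. s n \<in> pts X1" and w: "w0 \<in> pts X0" "w1 \<in> pts X1"
    and lim0: "(\<lambda>n. nrm X0 (w0 - s n)) \<longlonglongrightarrow> 0" and lim1: "(\<lambda>n. nrm X1 (w1 - s n)) \<longlonglongrightarrow> 0"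
  shows "w0 = w1"
proof -
  obtain \<tau> where \<tau>: "hausdorff_linear_topology \<tau>"
    "continuously_embedded X0 \<tau>" "continuously_embedded X1 \<tau>"
    and n: "normed_space X0" "normed_space X1"
    using couple by (auto simp: banach_couple_def banach_space_def)
  have lim: "limitin \<tau> s w sequentially"
    if X: "normed_space X" "continuously_embedded X \<tau>" "w \<in> pts X" "\<And>n. s n \<in> pts X"
      and lim: "(\<lambda>n. nrm X (w - s n)) \<longlonglongrightarrow> 0" for X w
  proof -
    interpret seminormed X
      using X(1) by (rule normed_space_seminormed)
    interpret M: Metric_space "pts X" "ndist X"
      using X(1) by (rule normed_space_Metric_space)
    have "limitin M.mtopology s w sequentially"
      unfolding M.limitin_metric
    proof (intro conjI allI impI X)
      fix e :: real assume "0 < e"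
      with lim have "eventually (\<lambda>n. nrm X (w - s n) < e) sequentially"
        by (rule order_tendstoD)
      then show "eventually (\<lambda>n. s n \<in> pts X \<and> ndist X (s n) w < e) sequentially"
        by eventually_elim (use X in \<open>simp add: ndist_def nrm_diff_commute\<close>)
    qed
    from continuous_map_limit[OF X(2)[unfolded continuously_embedded_def] this]
    show ?thesis by (simp add: o_def)
  qed
  show ?thesis
    using \<tau> lim[OF n(1) \<tau>(2) w(1) s(1) lim0] lim[OF n(2) \<tau>(3) w(2) s(2) lim1]
    by (auto simp: hausdorff_linear_topology_def intro: limitin_Hausdorff_unique)
qed

section \<open>The sum of two normed spaces\<close>

lemma mem_sum_space: "x \<in> pts (sum_space X0 X1) \<longleftrightarrow> (\<exists>x0\<in>pts X0. \<exists>x1\<in>pts X1. x = x0 + x1)"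
  by (auto simp: sum_space_def)

lemma sum_space_nrm_le:
  assumes "seminormed X0" "seminormed X1" "x0 \<in> pts X0" "x1 \<in> pts X1"
  shows "nrm (sum_space X0 X1) (x0 + x1) \<le> nrm X0 x0 + nrm X1 x1"
proof -
  interpret X0: seminormed X0 by fact
  interpret X1: seminormed X1 by fact
  show ?thesis
    using assms(3,4)
    by (auto simp: sum_space_def intro!: cInf_lower bdd_belowI[of _ 0] add_nonneg_nonneg
        X0.nrm_nonneg X1.nrm_nonneg)
qed

lemma sum_space_nrm_approx:
  assumes "x \<in> pts (sum_space X0 X1)" "0 < e"
  obtains x0 x1 where "x0 \<in> pts X0" "x1 \<in> pts X1" "x = x0 + x1"
    "nrm X0 x0 + nrm X1 x1 < nrm (sum_space X0 X1) x + e"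
proof -
  let ?A = "{nrm X0 x0 + nrm X1 x1 | x0 x1. x0 \<in> pts X0 \<and> x1 \<in> pts X1 \<and> x = x0 + x1}"
  have "?A \<noteq> {}"
    using assms(1) unfolding mem_sum_space by blast
  moreover have "Inf ?A < nrm (sum_space X0 X1) x + e"
    using assms(2) by (simp add: sum_space_def)
  ultimately have "\<exists>y\<in>?A. y < nrm (sum_space X0 X1) x + e"
    by (rule cInf_lessD)
  then show ?thesis using that by blast
qed

lemma seminormed_sum_space:
  assumes "seminormed X0" "seminormed X1"
  shows "seminormed (sum_space X0 X1)"
proof -
  interpret X0: seminormed X0 by fact
  interpret X1: seminormed X1 by fact
  let ?S = "sum_space X0 X1"
  have scale: "nrm ?S (c *\<^sub>R x) \<le> \<bar>c\<bar> * nrm ?S x" if x: "x \<in> pts ?S" for c x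
  proof (rule field_le_epsilon)
    fix e :: real assume "0 < e"
    \<comment> \<open>The added 1 allows for c = 0 and keeps the total error below e.\<close>
    then have "0 < e / (\<bar>c\<bar> + 1)"
      by (intro divide_pos_pos) auto
    then obtain x0 x1 where x: "x0 \<in> pts X0" "x1 \<in> pts X1" "x = x0 + x1"
      "nrm X0 x0 + nrm X1 x1 < nrm ?S x + e / (\<bar>c\<bar> + 1)"
      using sum_space_nrm_approx[OF x] by metis
    have "nrm ?S (c *\<^sub>R x) \<le> nrm X0 (c *\<^sub>R x0) + nrm X1 (c *\<^sub>R x1)"
      unfolding x(3) scaleR_add_right
      by (intro sum_space_nrm_le assms X0.scale_mem X1.scale_mem x)
    also have "\<dots> = \<bar>c\<bar> * (nrm X0 x0 + nrm X1 x1)"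
      using x by (simp add: X0.nrm_scale X1.nrm_scale algebra_simps)
    also have "\<dots> \<le> \<bar>c\<bar> * (nrm ?S x + e / (\<bar>c\<bar> + 1))"
      using x by (intro mult_left_mono) auto
    also have "\<dots> \<le> \<bar>c\<bar> * nrm ?S x + e"
      using \<open>0 < e\<close> by (simp add: distrib_left field_simps)
    finally show "nrm ?S (c *\<^sub>R x) \<le> \<bar>c\<bar> * nrm ?S x + e" .
  qed
  have mem_scale: "c *\<^sub>R x \<in> pts ?S" if "x \<in> pts ?S" for c x
    using that X0.scale_mem X1.scale_mem unfolding mem_sum_space by (metis scaleR_add_right)
  show ?thesis
  proof
    show "subspace (pts ?S)"
      unfolding sum_space_def by (auto intro: subspace_sums X0.subspace_pts X1.subspace_pts)
    fix x y assume x: "x \<in> pts ?S"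
    then show nonneg: "0 \<le> nrm ?S x"
      by (auto simp: sum_space_def intro!: cInf_greatest add_nonneg_nonneg X0.nrm_nonneg X1.nrm_nonneg)
    show "nrm ?S (c *\<^sub>R x) = \<bar>c\<bar> * nrm ?S x" for c
    proof (rule antisym)
      show "nrm ?S (c *\<^sub>R x) \<le> \<bar>c\<bar> * nrm ?S x"
        by (rule scale[OF x])
      show "\<bar>c\<bar> * nrm ?S x \<le> nrm ?S (c *\<^sub>R x)"
      proof (cases "c = 0")
        case True
        have "0 \<in> pts ?S"
          using X0.zero_mem X1.zero_mem unfolding mem_sum_space by (metis add_0)
        then have "0 \<le> nrm ?S 0"
          by (auto simp: sum_space_def intro!: cInf_greatest add_nonneg_nonneg X0.nrm_nonneg X1.nrm_nonneg)
        then show ?thesis using True by simp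
      next
        case False
        then have "nrm ?S x \<le> \<bar>inverse c\<bar> * nrm ?S (c *\<^sub>R x)"
          using scale[OF mem_scale[OF x], of "inverse c" c] by simp
        then show ?thesis
          using False by (simp add: field_simps)
      qed
    qed
    assume y: "y \<in> pts ?S"
    show "nrm ?S (x + y) \<le> nrm ?S x + nrm ?S y"
    proof (rule field_le_epsilon)
      fix e :: real assume "0 < e"
      then have e: "0 < e / 2" by simp
      obtain x0 x1 where x: "x0 \<in> pts X0" "x1 \<in> pts X1" "x = x0 + x1"
        "nrm X0 x0 + nrm X1 x1 < nrm ?S x + e / 2"
        using sum_space_nrm_approx[OF x e] .
      obtain y0 y1 where y: "y0 \<in> pts X0" "y1 \<in> pts X1" "y = y0 + y1"
        "nrm X0 y0 + nrm X1 y1 < nrm ?S y + e / 2"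
        using sum_space_nrm_approx[OF y e] .
      have "nrm ?S ((x0 + y0) + (x1 + y1)) \<le> nrm X0 (x0 + y0) + nrm X1 (x1 + y1)"
        by (intro sum_space_nrm_le assms X0.add_mem X1.add_mem x y)
      also have "\<dots> \<le> (nrm X0 x0 + nrm X0 y0) + (nrm X1 x1 + nrm X1 y1)"
        by (intro add_mono X0.nrm_triangle X1.nrm_triangle x y)
      finally show "nrm ?S (x + y) \<le> nrm ?S x + nrm ?S y + e"
        using x y by (simp add: ac_simps)
    qed
  qed
qed

lemma
  assumes "seminormed X0" "seminormed X1"
  shows sum_space_left: "x \<in> pts X0 \<Longrightarrow> x \<in> pts (sum_space X0 X1) \<and> nrm (sum_space X0 X1) x \<le> nrm X0 x"
    and sum_space_right: "x \<in> pts X1 \<Longrightarrow> x \<in> pts (sum_space X0 X1) \<and> nrm (sum_space X0 X1) x \<le> nrm X1 x"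
proof -
  have z: "0 \<in> pts X0" "nrm X0 0 = 0" "0 \<in> pts X1" "nrm X1 0 = 0"
    using assms by (simp_all add: seminormed.zero_mem seminormed.nrm_zero)
  show "x \<in> pts X0 \<Longrightarrow> x \<in> pts (sum_space X0 X1) \<and> nrm (sum_space X0 X1) x \<le> nrm X0 x"
    using sum_space_nrm_le[OF assms, of x 0] z unfolding mem_sum_space
    by (intro conjI bexI[of _ x] bexI[of _ 0]) simp_all
  show "x \<in> pts X1 \<Longrightarrow> x \<in> pts (sum_space X0 X1) \<and> nrm (sum_space X0 X1) x \<le> nrm X1 x"
    using sum_space_nrm_le[OF assms, of 0 x] z unfolding mem_sum_space
    by (intro conjI bexI[of _ x] bexI[of _ 0]) simp_all
qed

lemma J_fun_nonneg:
  assumes "seminormed X0" "x \<in> pts X0"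
  shows "0 \<le> J_fun X0 X1 t x"
  using seminormed.nrm_nonneg[OF assms] by (simp add: J_fun_def)

text \<open>The two trivial splittings x + 0 and 0 + x give the two bounds. Their minimum is the
  weight in the integrability condition, which is why that condition controls convergence in the sum
  space.\<close>

lemma sum_space_nrm_le_J_fun:
  assumes "seminormed X0" "seminormed X1" "x \<in> pts X0" "x \<in> pts X1" "0 < t"
  shows "nrm (sum_space X0 X1) x \<le> min 1 (1 / t) * J_fun X0 X1 t x"
proof -
  have "nrm (sum_space X0 X1) x \<le> J_fun X0 X1 t x"
    using sum_space_left[OF assms(1-3)] by (auto simp: J_fun_def)
  moreover have "nrm (sum_space X0 X1) x \<le> 1 / t * J_fun X0 X1 t x"
  proof -
    have "nrm (sum_space X0 X1) x \<le> 1 / t * (t * nrm X1 x)"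
      using sum_space_right[OF assms(1,2,4)] assms by simp
    also have "\<dots> \<le> 1 / t * J_fun X0 X1 t x"
      using assms by (intro mult_left_mono) (auto simp: J_fun_def)
    finally show ?thesis .
  qed
  ultimately show ?thesis
    by (simp add: min_def)
qed

section \<open>Bounded bilinear operators\<close>

text \<open>Lets e tend to 0 in two factors at once: in the homogeneity argument for the operator
  norm and for near-optimal representations of both arguments.\<close>

lemma le_product_limit:
  fixes u M a b :: real
  assumes "\<And>e. 0 < e \<Longrightarrow> u \<le> M * (a + e) * (b + e)"
  shows "u \<le> M * a * b"
proof (rule tendsto_lowerbound)
  show "((\<lambda>e. M * (a + e) * (b + e)) \<longlongrightarrow> M * a * b) (at_right 0)"
    by (auto intro!: tendsto_eq_intros)
  show "eventually (\<lambda>e. u \<le> M * (a + e) * (b + e)) (at_right 0)"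
    using assms by (auto simp: eventually_at_filter)
qed auto

lemma bil_norm_bound:
  assumes X: "seminormed X" and Y: "seminormed Y" and Z: "seminormed Z" and T: "T \<in> Bil X Y Z"
  shows "0 \<le> bil_norm X Y Z T"
    and "x \<in> pts X \<Longrightarrow> y \<in> pts Y \<Longrightarrow> nrm Z (T x y) \<le> bil_norm X Y Z T * nrm X x * nrm Y y"
proof -
  interpret X: seminormed X by fact
  interpret Y: seminormed Y by fact
  interpret Z: seminormed Z by fact
  have bl: "bilinear_between X Y Z T" and bdd: "bdd_above (unit_values X Y Z T)"
    using T by (auto simp: Bil_def)
  have le: "nrm Z (T x y) \<le> bil_norm X Y Z T"
    if "x \<in> pts X" "y \<in> pts Y" "nrm X x \<le> 1" "nrm Y y \<le> 1" for x y
    unfolding bil_norm_def using that by (intro cSup_upper bdd) (auto simp: unit_values_def)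
  have mem: "T x y \<in> pts Z" if "x \<in> pts X" "y \<in> pts Y" for x y
    using that bl by (auto simp: bilinear_between_def)
  show "0 \<le> bil_norm X Y Z T"
    using le[of 0 0] Z.nrm_nonneg[OF mem, of 0 0]
    by (simp add: X.zero_mem Y.zero_mem X.nrm_zero Y.nrm_zero)
  assume x: "x \<in> pts X" and y: "y \<in> pts Y"
  show "nrm Z (T x y) \<le> bil_norm X Y Z T * nrm X x * nrm Y y"
  proof (rule le_product_limit)
    fix e :: real assume e: "0 < e"
    \<comment> \<open>Adding e makes rescaling possible also for vectors of seminorm 0.\<close>
    define a b where "a = nrm X x + e" and "b = nrm Y y + e"
    have ab: "0 < a" "0 < b" "nrm X x \<le> a" "nrm Y y \<le> b"
      using e X.nrm_nonneg[OF x] Y.nrm_nonneg[OF y] by (auto simp: a_def b_def)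
    have "T (inverse a *\<^sub>R x) (inverse b *\<^sub>R y) = (inverse a * inverse b) *\<^sub>R T x y"
      using bl x y Y.scale_mem[OF y] by (simp add: bilinear_between_def)
    moreover have "nrm Z (T (inverse a *\<^sub>R x) (inverse b *\<^sub>R y)) \<le> bil_norm X Y Z T"
      using ab x y by (intro le) (auto simp: X.scale_mem Y.scale_mem X.nrm_scale Y.nrm_scale field_simps)
    ultimately have "inverse a * inverse b * nrm Z (T x y) \<le> bil_norm X Y Z T"
      using ab Z.nrm_scale[OF mem[OF x y]] by simp
    then show "nrm Z (T x y) \<le> bil_norm X Y Z T * (nrm X x + e) * (nrm Y y + e)"
      unfolding a_def[symmetric] b_def[symmetric] using ab by (simp add: field_simps)
  qed
qed

section \<open>Rearranging double series\<close>

text \<open>A square of indices catches all but e/3 of the double series and nearly reproduces t. A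
  long partial sum of w covers every diagonal that meets the square, and the error of each
  \<open>w n\<close> is at most the part of its diagonal outside the square. These parts are
  disjoint, so all errors together stay below e/3 however many diagonals occur.\<close>

lemma (in seminormed) bilateral_sums_regroup:
  fixes z :: "int \<Rightarrow> int \<Rightarrow> 'v" and m :: int
  assumes z: "\<And>k l. z k l \<in> pts X" and t: "t \<in> pts X" and w: "\<And>n. w n \<in> pts X"
    and summable: "(\<lambda>(k, l). nrm X (z k l)) summable_on UNIV"
    and lim: "(\<lambda>K. nrm X (t - (\<Sum>k\<in>{- int K..int K}. \<Sum>l\<in>{- int K..int K}. z k l))) \<longlonglongrightarrow> 0"
    and tail: "\<And>n F. finite F \<Longrightarrow>
      nrm X (w n - (\<Sum>k\<in>F. z k (n + m - k))) \<le> (\<Sum>\<^sub>\<infinity>k\<in>- F. nrm X (z k (n + m - k)))"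
  shows "bilateral_sums X w t"
  unfolding bilateral_sums_def
proof (intro allI impI)
  fix e :: real assume e: "0 < e"
  define g where "g = (\<lambda>(k, l). nrm X (z k l))"
  have g0: "0 \<le> g p" for p
    using z by (simp add: g_def nrm_nonneg split: prod.split)
  have g: "g summable_on A" for A
    using summable_on_subset_banach[OF summable subset_UNIV] by (simp add: g_def)
  obtain F0 where F0: "finite F0" "dist (sum g F0) (infsum g UNIV) \<le> e / 3"
    using infsum_finite_approximation[OF g[of UNIV], of "e / 3"] e by auto
  define I where "I K = {- int K..int K}" for K
  obtain K0 where K0: "F0 \<subseteq> I K0 \<times> I K0"
  proof -
    let ?a = "\<lambda>p. nat (\<bar>fst p\<bar> + \<bar>snd p\<bar>)"
    have "p \<in> I (Max (?a ` F0)) \<times> I (Max (?a ` F0))" if "p \<in> F0" for p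
    proof -
      have "?a p \<le> Max (?a ` F0)"
        using F0 that by (intro Max_ge) auto
      then show ?thesis by (cases p) (auto simp: I_def)
    qed
    then show ?thesis using that by blast
  qed
  have "eventually (\<lambda>K. nrm X (t - (\<Sum>k\<in>I K. \<Sum>l\<in>I K. z k l)) < e / 3 \<and> K0 \<le> K) sequentially"
    using e unfolding I_def by (intro eventually_conj eventually_ge_at_top order_tendstoD[OF lim]) auto
  then obtain K where K: "nrm X (t - (\<Sum>k\<in>I K. \<Sum>l\<in>I K. z k l)) < e / 3" "K0 \<le> K"
    by (auto simp: eventually_sequentially)
  define R where "R = I K \<times> I K"
  have R: "finite R" "F0 \<subseteq> R"
    using K0 K(2) by (force simp: R_def I_def)+
  have "infsum g UNIV = infsum g (R \<union> - R)"
    by simp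
  also have "\<dots> = sum g R + infsum g (- R)"
    using R by (subst infsum_Un_disjoint) (auto simp: g)
  finally have "infsum g UNIV = sum g R + infsum g (- R)" .
  moreover have "sum g F0 \<le> sum g R"
    using R g0 by (intro sum_mono2) auto
  ultimately have tailR: "infsum g (- R) \<le> e / 3"
    using F0(2) unfolding dist_real_def by linarith
  show "\<exists>N. \<forall>a\<ge>N. \<forall>b\<ge>N. nrm X (t - sum w {- int a..int b}) < e"
  proof (intro exI allI impI)
    \<comment> \<open>Inside the square k + l lies in [-2K, 2K], so n = k + l - m satisfies |n|
      \<le> 2K + |m|.\<close>
    fix a b assume ab: "2 * K + nat \<bar>m\<bar> \<le> a" "2 * K + nat \<bar>m\<bar> \<le> b"
    define D where "D = {- int a..int b}"
    define F where "F n = {k \<in> I K. n + m - k \<in> I K}" for n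
    have F: "finite (F n)" for n
      by (rule finite_subset[of _ "I K"]) (auto simp: F_def I_def)
    have regroup: "(\<Sum>n\<in>D. \<Sum>k\<in>F n. z k (n + m - k)) = (\<Sum>k\<in>I K. \<Sum>l\<in>I K. z k l)"
    proof -
      have "(\<Sum>n\<in>D. \<Sum>k\<in>F n. z k (n + m - k)) = (\<Sum>(n, k)\<in>Sigma D F. z k (n + m - k))"
        using F by (subst sum.Sigma) (auto simp: D_def)
      also have "\<dots> = (\<Sum>(k, l)\<in>I K \<times> I K. z k l)"
        by (rule sum.reindex_bij_witness[of _ "\<lambda>(k, l). (k + l - m, k)" "\<lambda>(n, k). (k, n + m - k)"])
          (use ab in \<open>auto simp: F_def D_def I_def\<close>)
      also have "\<dots> = (\<Sum>k\<in>I K. \<Sum>l\<in>I K. z k l)"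
        by (simp add: sum.cartesian_product)
      finally show ?thesis .
    qed
    \<comment> \<open>The part of the n-th diagonal outside the square. Diagonals for different n
      are disjoint, so the tail sums add up to one sum over a subset of the complement of R.\<close>
    define B where "B n = (\<lambda>k. (k, n + m - k)) ` (- F n)" for n
    have B: "infsum g (B n) = (\<Sum>\<^sub>\<infinity>k\<in>- F n. nrm X (z k (n + m - k)))" for n
      unfolding B_def by (subst infsum_reindex) (auto simp: inj_on_def g_def o_def)
    have "nrm X (sum w D - (\<Sum>k\<in>I K. \<Sum>l\<in>I K. z k l))
        = nrm X (\<Sum>n\<in>D. w n - (\<Sum>k\<in>F n. z k (n + m - k)))"
      by (simp add: sum_subtractf regroup)
    also have "\<dots> \<le> (\<Sum>n\<in>D. nrm X (w n - (\<Sum>k\<in>F n. z k (n + m - k))))"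
      using z w by (intro nrm_sum diff_mem sum_mem)
    also have "\<dots> \<le> (\<Sum>n\<in>D. infsum g (B n))"
      unfolding B by (intro sum_mono tail F)
    also have "\<dots> = infsum g (\<Union>n\<in>D. B n)"
      by (rule sum_infsum) (auto simp: D_def B_def g)
    also have "\<dots> \<le> infsum g (- R)"
      by (rule infsum_mono_neutral) (auto simp: g g0 B_def F_def R_def)
    also note tailR
    finally have 1: "nrm X ((\<Sum>k\<in>I K. \<Sum>l\<in>I K. z k l) - sum w D) \<le> e / 3"
      using z w by (subst nrm_diff_commute) (auto intro: sum_mem)
    have "nrm X (t - sum w D) \<le> nrm X (t - (\<Sum>k\<in>I K. \<Sum>l\<in>I K. z k l))
        + nrm X ((\<Sum>k\<in>I K. \<Sum>l\<in>I K. z k l) - sum w D)"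
      using z w t by (intro nrm_diff_triangle sum_mem)
    then show "nrm X (t - sum w {- int a..int b}) < e"
      using 1 K(1) e by (simp add: D_def)
  qed
qed

lemma bilinear_between_sum:
  assumes X: "seminormed X" and Y: "seminormed Y" and T: "bilinear_between X Y Z T"
    and u: "\<And>k. u k \<in> pts X" and v: "\<And>l. v l \<in> pts Y"
  shows "T (sum u I) (sum v L) = (\<Sum>k\<in>I. \<Sum>l\<in>L. T (u k) (v l))"
proof -
  interpret X: seminormed X by fact
  interpret Y: seminormed Y by fact
  have zero: "T 0 y = 0" "T x 0 = 0" if "x \<in> pts X" "y \<in> pts Y" for x y
  proof -
    have "T (0 *\<^sub>R x) y = 0 *\<^sub>R T x y" "T x (0 *\<^sub>R y) = 0 *\<^sub>R T x y"
      using T that unfolding bilinear_between_def by blast+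
    then show "T 0 y = 0" "T x 0 = 0" by simp_all
  qed
  have right: "T x (sum v L) = (\<Sum>l\<in>L. T x (v l))" if x: "x \<in> pts X" for x
  proof (induction L rule: infinite_finite_induct)
    case (insert l L)
    moreover have "T x (v l + sum v L) = T x (v l) + T x (sum v L)"
      using T x v Y.sum_mem[of L v] unfolding bilinear_between_def by blast
    ultimately show ?case by simp
  qed (use zero[OF x v] in auto)
  show ?thesis
  proof (induction I rule: infinite_finite_induct)
    case (insert k I)
    moreover have "T (u k + sum u I) (sum v L) = T (u k) (sum v L) + T (sum u I) (sum v L)"
      using T u v Y.sum_mem[of L v] X.sum_mem[of I u] unfolding bilinear_between_def by blast
    ultimately show ?case by (simp add: right[OF u])
  qed (use zero[OF u Y.sum_mem[OF v]] in auto)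
qed

lemma bilateral_sums_tendsto:
  assumes "seminormed X" "x \<in> pts X" "\<And>k. u k \<in> pts X" "bilateral_sums X u x"
  shows "(\<lambda>N. nrm X (x - (\<Sum>k\<in>{- int N..int N}. u k))) \<longlonglongrightarrow> 0"
proof (rule tendstoI)
  interpret seminormed X by fact
  fix e :: real assume "0 < e"
  then obtain N where "\<forall>m\<ge>N. \<forall>n\<ge>N. nrm X (x - (\<Sum>k\<in>{- int m..int n}. u k)) < e"
    using assms(4) unfolding bilateral_sums_def by blast
  then show "eventually (\<lambda>N. dist (nrm X (x - (\<Sum>k\<in>{- int N..int N}. u k))) 0 < e) sequentially"
    using assms by (auto simp: eventually_sequentially nrm_nonneg diff_mem sum_mem)
qed

text \<open>The square partial sums are the values of T at partial sums p and q, and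
  \<open>T x y - T p q = T (x - p) y + T p (y - q)\<close>. The norm of p stays bounded because p
  approaches x.\<close>

lemma bilinear_partial_sums_tendsto:
  assumes X: "seminormed X" and Y: "seminormed Y" and Z: "seminormed Z" and T: "T \<in> Bil X Y Z"
    and x: "x \<in> pts X" "\<And>k. u k \<in> pts X" "bilateral_sums X u x"
    and y: "y \<in> pts Y" "\<And>l. v l \<in> pts Y" "bilateral_sums Y v y"
  shows "(\<lambda>N. nrm Z (T x y - (\<Sum>k\<in>{- int N..int N}. \<Sum>l\<in>{- int N..int N}. T (u k) (v l)))) \<longlonglongrightarrow> 0"
proof -
  interpret X: seminormed X by fact
  interpret Y: seminormed Y by fact
  interpret Z: seminormed Z by fact
  have bl: "bilinear_between X Y Z T"
    using T by (simp add: Bil_def)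
  have mem: "T x y \<in> pts Z" if "x \<in> pts X" "y \<in> pts Y" for x y
    using bl that by (simp add: bilinear_between_def)
  define M where "M = bil_norm X Y Z T"
  define p q where "p N = (\<Sum>k\<in>{- int N..int N}. u k)" and "q N = (\<Sum>l\<in>{- int N..int N}. v l)" for N
  have pq: "p N \<in> pts X" "q N \<in> pts Y" for N
    unfolding p_def q_def using x y by (auto intro: X.sum_mem Y.sum_mem)
  have limp: "(\<lambda>N. nrm X (x - p N)) \<longlonglongrightarrow> 0" and limq: "(\<lambda>N. nrm Y (y - q N)) \<longlonglongrightarrow> 0"
    unfolding p_def q_def using bilateral_sums_tendsto[OF X x] bilateral_sums_tendsto[OF Y y] by auto
  have bound: "nrm Z (T x y - T (p N) (q N))
      \<le> M * nrm X (x - p N) * nrm Y y + M * (nrm X x + nrm X (x - p N)) * nrm Y (y - q N)" for N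
  proof -
    have "T ((x - p N) + p N) y = T (x - p N) y + T (p N) y"
      using bl X.diff_mem[OF x(1) pq(1)] pq y(1) unfolding bilinear_between_def by blast
    moreover have "T (p N) ((y - q N) + q N) = T (p N) (y - q N) + T (p N) (q N)"
      using bl Y.diff_mem[OF y(1) pq(2)] pq unfolding bilinear_between_def by blast
    ultimately have "T x y - T (p N) (q N) = T (x - p N) y + T (p N) (y - q N)"
      by simp
    then have "nrm Z (T x y - T (p N) (q N)) \<le> nrm Z (T (x - p N) y) + nrm Z (T (p N) (y - q N))"
      using x y pq by (simp add: Z.nrm_triangle mem X.diff_mem Y.diff_mem)
    also have "nrm Z (T (x - p N) y) \<le> M * nrm X (x - p N) * nrm Y y"
      unfolding M_def using x y pq by (intro bil_norm_bound X Y Z T X.diff_mem)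
    also have "nrm Z (T (p N) (y - q N)) \<le> M * nrm X (p N) * nrm Y (y - q N)"
      unfolding M_def using x y pq by (intro bil_norm_bound X Y Z T Y.diff_mem)
    also have "\<dots> \<le> M * (nrm X x + nrm X (x - p N)) * nrm Y (y - q N)"
    proof (intro mult_right_mono mult_left_mono)
      show "nrm X (p N) \<le> nrm X x + nrm X (x - p N)"
        using X.nrm_triangle[OF x(1) X.diff_mem[OF pq(1) x(1)], of N] x pq
        by (simp add: X.nrm_diff_commute)
      show "0 \<le> M"
        unfolding M_def by (rule bil_norm_bound[OF X Y Z T])
    qed (intro Y.nrm_nonneg Y.diff_mem y pq)
    finally show ?thesis by simp
  qed
  have "(\<lambda>N. M * nrm X (x - p N) * nrm Y y + M * (nrm X x + nrm X (x - p N)) * nrm Y (y - q N)) \<longlonglongrightarrow> 0"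
    by (rule tendsto_eq_intros limp limq refl | simp)+
  then have "(\<lambda>N. nrm Z (T x y - T (p N) (q N))) \<longlonglongrightarrow> 0"
    by (rule tendsto_sandwich[OF _ _ tendsto_const, rotated 2])
      (use bound x y pq in \<open>auto intro!: always_eventually Z.nrm_nonneg Z.diff_mem mem\<close>)
  moreover have "T (p N) (q N) = (\<Sum>k\<in>{- int N..int N}. \<Sum>l\<in>{- int N..int N}. T (u k) (v l))" for N
    unfolding p_def q_def by (rule bilinear_between_sum[OF X Y bl x(2) y(2)])
  ultimately show ?thesis
    by simp
qed

section \<open>The J-method\<close>

lemma banach_couple_normed:
  "banach_couple X0 X1 \<Longrightarrow> normed_space X0" "banach_couple X0 X1 \<Longrightarrow> normed_space X1"
  by (auto simp: banach_couple_def banach_space_def)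

lemma banach_couple_seminormed:
  assumes "banach_couple X0 X1"
  shows "seminormed X0" "seminormed X1" "seminormed (sum_space X0 X1)"
  using banach_couple_normed[OF assms] by (auto intro: normed_space_seminormed seminormed_sum_space)

text \<open>\<open>J_fun\<close> dominates both norms up to a factor, so the series converges
  absolutely in X0 and in X1 and the two limits coincide. The tail bound records in the sum norm,
  for every finite F, that w is the sum of the series.\<close>

lemma banach_couple_series:
  fixes z :: "int \<Rightarrow> 'v::real_vector"
  assumes couple: "banach_couple X0 X1" and z: "\<And>k. z k \<in> pts X0" "\<And>k. z k \<in> pts X1" and t: "0 < t"
    and summable: "(\<lambda>k. J_fun X0 X1 t (z k)) summable_on UNIV"
  shows "\<exists>w\<in>pts X0 \<inter> pts X1. J_fun X0 X1 t w \<le> (\<Sum>\<^sub>\<infinity>k. J_fun X0 X1 t (z k)) \<and>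
    (\<forall>F. finite F \<longrightarrow> nrm (sum_space X0 X1) (w - sum z F) \<le> (\<Sum>\<^sub>\<infinity>k\<in>- F. nrm (sum_space X0 X1) (z k)))"
proof -
  interpret X0: seminormed X0 by (rule banach_couple_seminormed[OF couple])
  interpret X1: seminormed X1 by (rule banach_couple_seminormed[OF couple])
  interpret S: seminormed "sum_space X0 X1" by (rule banach_couple_seminormed[OF couple])
  have bs: "banach_space X0" "banach_space X1"
    using couple by (auto simp: banach_couple_def)
  have le: "nrm X0 x \<le> J_fun X0 X1 t x" "nrm X1 x \<le> inverse t * J_fun X0 X1 t x" for x
    using t by (auto simp: J_fun_def field_simps)
  have s0: "(\<lambda>k. nrm X0 (z k)) summable_on UNIV"
    by (rule summable_on_comparison_test[OF summable]) (use le z in \<open>auto intro: X0.nrm_nonneg\<close>)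
  have s1: "(\<lambda>k. nrm X1 (z k)) summable_on UNIV"
    by (rule summable_on_comparison_test[OF summable_on_cmult_right[OF summable, of "inverse t"]])
      (use le z in \<open>auto intro: X1.nrm_nonneg\<close>)
  have leS: "nrm (sum_space X0 X1) x \<le> nrm X0 x" if "x \<in> pts X0" for x
    using sum_space_left[OF X0.seminormed_axioms X1.seminormed_axioms that] by simp
  have memS: "x \<in> pts (sum_space X0 X1)" if "x \<in> pts X0" for x
    using sum_space_left[OF X0.seminormed_axioms X1.seminormed_axioms that] by simp
  obtain w where w: "w \<in> pts X0" "(\<lambda>N. nrm X0 (w - (\<Sum>k\<in>{- int N..int N}. z k))) \<longlonglongrightarrow> 0"
    using banach_absolutely_convergent[OF bs(1) z(1) s0] .
  obtain w1 where w1: "w1 \<in> pts X1" "(\<lambda>N. nrm X1 (w1 - (\<Sum>k\<in>{- int N..int N}. z k))) \<longlonglongrightarrow> 0"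
    using banach_absolutely_convergent[OF bs(2) z(2) s1] .
  have "w = w1"
    by (rule banach_couple_limit_unique[OF couple X0.sum_mem X1.sum_mem w(1) w1(1) w(2) w1(2)]) (rule z)+
  with w1 have w1: "w \<in> pts X1" "(\<lambda>N. nrm X1 (w - (\<Sum>k\<in>{- int N..int N}. z k))) \<longlonglongrightarrow> 0"
    by simp_all
  have "nrm X0 w \<le> (\<Sum>\<^sub>\<infinity>k. nrm X0 (z k))"
    using X0.nrm_diff_sum_le_tail[OF w(1) z(1) s0 w(2), of "{}"] by simp
  also have "\<dots> \<le> (\<Sum>\<^sub>\<infinity>k. J_fun X0 X1 t (z k))"
    by (intro infsum_mono s0 summable le)
  finally have 0: "nrm X0 w \<le> (\<Sum>\<^sub>\<infinity>k. J_fun X0 X1 t (z k))" .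
  have "t * nrm X1 w \<le> t * (\<Sum>\<^sub>\<infinity>k. nrm X1 (z k))"
    using X1.nrm_diff_sum_le_tail[OF w1(1) z(2) s1 w1(2), of "{}"] t by simp
  also have "\<dots> = (\<Sum>\<^sub>\<infinity>k. t * nrm X1 (z k))"
    by (simp add: infsum_cmult_right')
  also have "\<dots> \<le> (\<Sum>\<^sub>\<infinity>k. J_fun X0 X1 t (z k))"
    by (intro infsum_mono summable_on_cmult_right s1 summable) (simp add: J_fun_def)
  finally have 1: "t * nrm X1 w \<le> (\<Sum>\<^sub>\<infinity>k. J_fun X0 X1 t (z k))" .
  have sS: "(\<lambda>k. nrm (sum_space X0 X1) (z k)) summable_on UNIV"
    by (rule summable_on_comparison_test[OF s0]) (use z in \<open>auto intro: leS S.nrm_nonneg memS\<close>)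
  have limS: "(\<lambda>N. nrm (sum_space X0 X1) (w - (\<Sum>k\<in>{- int N..int N}. z k))) \<longlonglongrightarrow> 0"
  proof (rule tendsto_sandwich[OF _ _ tendsto_const w(2)])
    have "w - (\<Sum>k\<in>{- int N..int N}. z k) \<in> pts X0" for N
      using w z by (intro X0.diff_mem X0.sum_mem)
    then show "eventually (\<lambda>N. 0 \<le> nrm (sum_space X0 X1) (w - (\<Sum>k\<in>{- int N..int N}. z k))) sequentially"
      and "eventually (\<lambda>N. nrm (sum_space X0 X1) (w - (\<Sum>k\<in>{- int N..int N}. z k))
        \<le> nrm X0 (w - (\<Sum>k\<in>{- int N..int N}. z k))) sequentially"
      by (auto intro!: always_eventually leS S.nrm_nonneg memS)
  qed
  show ?thesis
    using S.nrm_diff_sum_le_tail[OF memS[OF w(1)] memS[OF z(1)] sS limS] 0 1 w w1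
    by (intro bexI[of _ w]) (auto simp: J_fun_def)
qed

lemma J_rep_mem: "J_rep X0 X1 x u \<Longrightarrow> u k \<in> pts X0 \<and> u k \<in> pts X1"
  by (simp add: J_rep_def inter_space_def)

lemma J_seq_nonneg:
  assumes "seminormed X0" "J_rep X0 X1 x u" "0 < f (2 powi k)"
  shows "0 \<le> J_seq X0 X1 f u k"
  using assms J_fun_nonneg[OF assms(1)] J_rep_mem[OF assms(2)] by (simp add: J_seq_def)

lemma J_space_memI:
  assumes "x \<in> pts (sum_space X0 X1)" "J_rep X0 X1 x u" "in_ell s (J_seq X0 X1 f u)"
  shows "x \<in> pts (J_space X0 X1 f s)" "nrm (J_space X0 X1 f s) x \<le> ell_norm s (J_seq X0 X1 f u)"
  using assms by (auto simp: J_space_def intro!: cInf_lower bdd_belowI[of _ 0] ell_norm_nonneg)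

lemma J_space_rep:
  assumes "x \<in> pts (J_space X0 X1 f s)" "0 < e"
  obtains u where "J_rep X0 X1 x u" "in_ell s (J_seq X0 X1 f u)"
    "ell_norm s (J_seq X0 X1 f u) < nrm (J_space X0 X1 f s) x + e"
proof -
  let ?A = "{ell_norm s (J_seq X0 X1 f u) | u. J_rep X0 X1 x u \<and> in_ell s (J_seq X0 X1 f u)}"
  have "?A \<noteq> {}"
    using assms(1) by (auto simp: J_space_def)
  moreover have "Inf ?A < nrm (J_space X0 X1 f s) x + e"
    using assms(2) by (simp add: J_space_def)
  ultimately have "\<exists>y\<in>?A. y < nrm (J_space X0 X1 f s) x + e"
    by (rule cInf_lessD)
  then show ?thesis using that by blast
qed

lemma J_space_nrm_nonneg: "x \<in> pts (J_space X0 X1 f s) \<Longrightarrow> 0 \<le> nrm (J_space X0 X1 f s) x"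
  by (auto simp: J_space_def intro!: cInf_greatest ell_norm_nonneg)

text \<open>Convergence of a representation is tested by the seminorm alone, so the zero sequence
  represents every null vector. This settles the case of a vanishing endpoint norm and, for x = 0,
  supplies a point of the unit ball.\<close>

lemma J_space_null:
  assumes "seminormed X0" "seminormed X1" "x \<in> pts (sum_space X0 X1)" "nrm (sum_space X0 X1) x = 0" "0 < s"
  shows "x \<in> pts (J_space X0 X1 f s)" "nrm (J_space X0 X1 f s) x = 0"
proof -
  have rep: "J_rep X0 X1 x (\<lambda>_. 0)"
    using assms by (auto simp: J_rep_def inter_space_def bilateral_sums_def seminormed.zero_mem)
  have seq: "J_seq X0 X1 f (\<lambda>_. 0) = (\<lambda>_. 0)"
    using assms by (simp add: J_seq_def J_fun_def seminormed.nrm_zero fun_eq_iff)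
  have "in_ell s (\<lambda>_. 0)" "ell_norm s (\<lambda>_. 0) = 0"
    by (auto simp: in_ell_def ell_norm_def)
  then show "x \<in> pts (J_space X0 X1 f s)" "nrm (J_space X0 X1 f s) x = 0"
    using J_space_memI[OF assms(3) rep, of s f] J_space_nrm_nonneg[of x X0 X1 f s] by (auto simp: seq)
qed

text \<open>Each entry of a sequence is bounded by its norm whatever the exponent s, so only the
  weights \<open>min 1 (2 powi (- k)) * f (2 powi k)\<close> have to be summable.\<close>

lemma J_rep_absolutely_summable:
  assumes X: "seminormed X0" "seminormed X1" and f: "\<And>t. 0 < t \<Longrightarrow> 0 < f t"
    and sf: "(\<lambda>k::int. min 1 (2 powi (- k)) * f (2 powi k)) summable_on UNIV"
    and u: "J_rep X0 X1 x u" "in_ell s (J_seq X0 X1 f u)" "0 < s"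
  shows "(\<lambda>k. nrm (sum_space X0 X1) (u k)) summable_on UNIV"
proof (rule summable_on_comparison_test)
  interpret S: seminormed "sum_space X0 X1"
    by (rule seminormed_sum_space[OF X])
  let ?L = "ell_norm s (J_seq X0 X1 f u)"
  show "(\<lambda>k. min 1 (2 powi (- k)) * f (2 powi k) * ?L) summable_on UNIV"
    by (rule summable_on_cmult_left[OF sf])
  fix k :: int
  have mem: "u k \<in> pts X0" "u k \<in> pts X1"
    using J_rep_mem[OF u(1)] by auto
  show "0 \<le> nrm (sum_space X0 X1) (u k)"
    using sum_space_left[OF X mem(1)] by (simp add: S.nrm_nonneg)
  have fk: "0 < f (2 powi k)"
    using f by simp
  have "nrm (sum_space X0 X1) (u k) \<le> min 1 (1 / 2 powi k) * J_fun X0 X1 (2 powi k) (u k)"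
    by (rule sum_space_nrm_le_J_fun[OF X mem]) simp
  also have "\<dots> = min 1 (2 powi (- k)) * f (2 powi k) * J_seq X0 X1 f u k"
    using fk by (simp add: J_seq_def power_int_minus divide_inverse)
  also have "\<dots> \<le> min 1 (2 powi (- k)) * f (2 powi k) * ?L"
    using abs_le_ell_norm[OF u(2,3), of k] fk by (intro mult_left_mono) auto
  finally show "nrm (sum_space X0 X1) (u k) \<le> min 1 (2 powi (- k)) * f (2 powi k) * ?L" .
qed

section \<open>Interpolation of bilinear operators\<close>

locale bilinear_interpolation =
  fixes E0 E1 :: "'e::real_vector nspace" and F0 F1 :: "'f::real_vector nspace"
    and G0 G1 :: "'g::real_vector nspace" and T :: "'e \<Rightarrow> 'f \<Rightarrow> 'g"
  assumes E: "banach_couple E0 E1" and F: "banach_couple F0 F1" and G: "banach_couple G0 G1"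
    and TS: "T \<in> Bil (sum_space E0 E1) (sum_space F0 F1) (sum_space G0 G1)"
    and T0: "T \<in> Bil E0 F0 G0" and T1: "T \<in> Bil E1 F1 G1"
begin

abbreviation "M0 \<equiv> bil_norm E0 F0 G0 T"
abbreviation "M1 \<equiv> bil_norm E1 F1 G1 T"

lemmas E_sn = banach_couple_seminormed[OF E]
lemmas F_sn = banach_couple_seminormed[OF F]
lemmas G_sn = banach_couple_seminormed[OF G]

lemma M_nonneg: "0 \<le> M0" "0 \<le> M1"
  using bil_norm_bound(1)[OF E_sn(1) F_sn(1) G_sn(1) T0] bil_norm_bound(1)[OF E_sn(2) F_sn(2) G_sn(2) T1]
  by auto

lemma T_mem:
  "x \<in> pts (sum_space E0 E1) \<Longrightarrow> y \<in> pts (sum_space F0 F1) \<Longrightarrow> T x y \<in> pts (sum_space G0 G1)"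
  "x \<in> pts E0 \<Longrightarrow> y \<in> pts F0 \<Longrightarrow> T x y \<in> pts G0"
  "x \<in> pts E1 \<Longrightarrow> y \<in> pts F1 \<Longrightarrow> T x y \<in> pts G1"
  using TS T0 T1 by (auto simp: Bil_def bilinear_between_def)

lemma T_le:
  "x \<in> pts E0 \<Longrightarrow> y \<in> pts F0 \<Longrightarrow> nrm G0 (T x y) \<le> M0 * nrm E0 x * nrm F0 y"
  "x \<in> pts E1 \<Longrightarrow> y \<in> pts F1 \<Longrightarrow> nrm G1 (T x y) \<le> M1 * nrm E1 x * nrm F1 y"
  using bil_norm_bound(2)[OF E_sn(1) F_sn(1) G_sn(1) T0] bil_norm_bound(2)[OF E_sn(2) F_sn(2) G_sn(2) T1]
  by auto

text \<open>The last hypothesis trades the endpoint norm M1 for M0, so that both entries of the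
  maximum get the same constant. For \<tau>, s, t equal to the powers of 2 with exponents n, k, l
  and k + l = n + m it reads \<open>M1 \<le> M0 * 2 powi m\<close>.\<close>

lemma J_fun_T_le:
  assumes u: "u \<in> pts E0" "u \<in> pts E1" and v: "v \<in> pts F0" "v \<in> pts F1"
    and t: "0 \<le> s" "0 \<le> t" "0 \<le> \<tau>" "\<tau> * M1 \<le> M0 * (s * t)"
  shows "J_fun G0 G1 \<tau> (T u v) \<le> M0 * (J_fun E0 E1 s u * J_fun F0 F1 t v)"
proof -
  have nn: "0 \<le> nrm E0 u" "0 \<le> nrm E1 u" "0 \<le> nrm F0 v" "0 \<le> nrm F1 v"
    using u v E_sn F_sn by (auto intro: seminormed.nrm_nonneg)
  have J: "nrm E0 u \<le> J_fun E0 E1 s u" "s * nrm E1 u \<le> J_fun E0 E1 s u"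
    "nrm F0 v \<le> J_fun F0 F1 t v" "t * nrm F1 v \<le> J_fun F0 F1 t v"
    by (auto simp: J_fun_def)
  have "nrm G0 (T u v) \<le> M0 * (nrm E0 u * nrm F0 v)"
    using T_le(1)[OF u(1) v(1)] by (simp add: mult.assoc)
  also have "\<dots> \<le> M0 * (J_fun E0 E1 s u * J_fun F0 F1 t v)"
    using nn J M_nonneg by (intro mult_left_mono mult_mono) auto
  finally have 0: "nrm G0 (T u v) \<le> M0 * (J_fun E0 E1 s u * J_fun F0 F1 t v)" .
  have "\<tau> * nrm G1 (T u v) \<le> (\<tau> * M1) * (nrm E1 u * nrm F1 v)"
    using mult_left_mono[OF T_le(2)[OF u(2) v(2)] t(3)] by (simp add: mult.assoc)
  also have "\<dots> \<le> (M0 * (s * t)) * (nrm E1 u * nrm F1 v)"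
    using nn t by (intro mult_right_mono) auto
  also have "\<dots> = M0 * ((s * nrm E1 u) * (t * nrm F1 v))"
    by (simp add: ac_simps)
  also have "\<dots> \<le> M0 * (J_fun E0 E1 s u * J_fun F0 F1 t v)"
    using nn J t M_nonneg by (intro mult_left_mono mult_mono) auto
  finally show ?thesis
    using 0 by (simp add: J_fun_def)
qed

lemma T_partial_sums_tendsto:
  assumes "x \<in> pts (sum_space E0 E1)" "J_rep E0 E1 x u" "y \<in> pts (sum_space F0 F1)" "J_rep F0 F1 y v"
  shows "(\<lambda>N. nrm (sum_space G0 G1)
    (T x y - (\<Sum>k\<in>{- int N..int N}. \<Sum>l\<in>{- int N..int N}. T (u k) (v l)))) \<longlonglongrightarrow> 0"
proof (rule bilinear_partial_sums_tendsto[OF E_sn(3) F_sn(3) G_sn(3) TS])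
  show "u k \<in> pts (sum_space E0 E1)" "v k \<in> pts (sum_space F0 F1)" for k
    using J_rep_mem[OF assms(2), of k] J_rep_mem[OF assms(4), of k]
      sum_space_left[OF E_sn(1,2)] sum_space_left[OF F_sn(1,2)] by auto
qed (use assms in \<open>auto simp: J_rep_def\<close>)

text \<open>The terms of both representations lie in both endpoint spaces, so one vanishing endpoint
  norm already makes every \<open>T (u k) (v l)\<close> null in the sum; the limit relation passes
  this on to \<open>T x y\<close>.\<close>

lemma T_null:
  assumes "M0 = 0 \<or> M1 = 0"
    and "x \<in> pts (sum_space E0 E1)" "J_rep E0 E1 x u" "y \<in> pts (sum_space F0 F1)" "J_rep F0 F1 y v"
  shows "nrm (sum_space G0 G1) (T x y) = 0"
proof -
  interpret S: seminormed "sum_space G0 G1" by (rule G_sn)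
  have mem: "T (u k) (v l) \<in> pts (sum_space G0 G1)"
    and z: "nrm (sum_space G0 G1) (T (u k) (v l)) \<le> 0" for k l
  proof -
    have u: "u k \<in> pts E0" "u k \<in> pts E1" and v: "v l \<in> pts F0" "v l \<in> pts F1"
      using J_rep_mem[OF assms(3)] J_rep_mem[OF assms(5)] by auto
    show "T (u k) (v l) \<in> pts (sum_space G0 G1)"
      using sum_space_left[OF G_sn(1,2) T_mem(2)[OF u(1) v(1)]] by simp
    show "nrm (sum_space G0 G1) (T (u k) (v l)) \<le> 0"
      using sum_space_left[OF G_sn(1,2) T_mem(2)[OF u(1) v(1)]] T_le(1)[OF u(1) v(1)]
        sum_space_right[OF G_sn(1,2) T_mem(3)[OF u(2) v(2)]] T_le(2)[OF u(2) v(2)] assms(1) by auto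
  qed
  define p where "p N = (\<Sum>k\<in>{- int N..int N}. \<Sum>l\<in>{- int N..int N}. T (u k) (v l))" for N
  have p: "p N \<in> pts (sum_space G0 G1)" "nrm (sum_space G0 G1) (p N) \<le> 0" for N
  proof -
    show "p N \<in> pts (sum_space G0 G1)"
      unfolding p_def using mem by (intro S.sum_mem)
    have "nrm (sum_space G0 G1) (p N)
        \<le> (\<Sum>k\<in>{- int N..int N}. nrm (sum_space G0 G1) (\<Sum>l\<in>{- int N..int N}. T (u k) (v l)))"
      unfolding p_def using mem by (intro S.nrm_sum S.sum_mem)
    also have "\<dots> \<le> (\<Sum>k\<in>{- int N..int N}. \<Sum>l\<in>{- int N..int N}. nrm (sum_space G0 G1) (T (u k) (v l)))"
      using mem by (intro sum_mono S.nrm_sum)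
    also have "\<dots> \<le> 0"
      using z by (intro sum_nonpos)
    finally show "nrm (sum_space G0 G1) (p N) \<le> 0" .
  qed
  have Txy: "T x y \<in> pts (sum_space G0 G1)"
    using assms by (intro T_mem)
  have "nrm (sum_space G0 G1) (T x y) \<le> 0"
  proof (rule tendsto_lowerbound[OF T_partial_sums_tendsto[OF assms(2-5)]])
    have "nrm (sum_space G0 G1) (T x y) \<le> nrm (sum_space G0 G1) (T x y - p N)" for N
      using S.nrm_triangle[OF S.diff_mem[OF Txy p(1)] p(1), of N N] p(2)[of N] by simp
    then show "eventually (\<lambda>N. nrm (sum_space G0 G1) (T x y) \<le> nrm (sum_space G0 G1)
        (T x y - (\<Sum>k\<in>{- int N..int N}. \<Sum>l\<in>{- int N..int N}. T (u k) (v l)))) sequentially"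
      by (simp add: p_def)
  qed simp
  then show ?thesis
    using S.nrm_nonneg[OF Txy] by simp
qed

end

section \<open>Estimates for representations\<close>

text \<open>Two dilations are composed: by \<open>2 powi (- k)\<close> from the point with exponent
  k + l to the one with exponent l, which produces \<gamma>, and by \<open>2 powi m\<close> from
  exponent n to n + m = k + l, which is the price of the shift.\<close>

lemma inverse_parameter_le:
  fixes k l m n :: int
  assumes B: "class_B \<rho>" and \<gamma>: "\<And>t. t > 0 \<Longrightarrow> \<gamma> t = inverse (dil \<rho> (inverse t))" and n: "n + m = k + l"
  shows "inverse (\<rho> (2 powi n)) \<le> dil \<rho> (2 powi m) * (inverse (\<gamma> (2 powi k)) * inverse (\<rho> (2 powi l)))"
proof -
  define a b c :: real where "a = 2 powi k" and "b = 2 powi l" and "c = 2 powi n"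
  have pos: "0 < a" "0 < b" "0 < c" "0 < (2::real) powi m"
    by (auto simp: a_def b_def c_def)
  have prod: "2 powi m * c = a * b"
    using n by (simp add: a_def b_def c_def add.commute flip: power_int_add)
  have "\<rho> (inverse a * (a * b)) \<le> dil \<rho> (inverse a) * \<rho> (a * b)"
    using pos by (intro le_dil B) auto
  also have "\<rho> (a * b) \<le> dil \<rho> (2 powi m) * \<rho> c"
    unfolding prod[symmetric] using pos by (intro le_dil B)
  finally have "\<rho> b \<le> dil \<rho> (inverse a) * (dil \<rho> (2 powi m) * \<rho> c)"
    using pos dil_pos[OF B, of "inverse a"] by (simp add: mult.assoc[symmetric])
  then have "inverse (\<rho> c) \<le> dil \<rho> (2 powi m) * (dil \<rho> (inverse a) * inverse (\<rho> b))"
    using class_B_pos[OF B pos(2)] class_B_pos[OF B pos(3)] by (simp add: field_simps)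
  then show ?thesis
    using \<gamma>[OF pos(1)] by (simp add: a_def b_def c_def)
qed

text \<open>
  The representation of \<open>T x y\<close> is the convolution \<open>w\<^sub>n = \<Sum>\<^sub>k T u\<^sub>k v\<^sub>l\<close> over \<open>k + l = n + m\<close>; the shift
  \<open>m\<close> absorbs the quotient of the two operator norms.
\<close>

lemma (in bilinear_interpolation) J_rep_T:
  fixes m :: int and p q r :: ereal
  assumes B: "class_Bpm \<rho>" and \<gamma>: "\<And>t. t > 0 \<Longrightarrow> \<gamma> t = inverse (dil \<rho> (inverse t))"
    and exps: "1 \<le> p" "1 \<le> q" "0 < r" "1 / r = 1 / p + 1 / q - 1"
    and m: "M1 \<le> M0 * 2 powi m"
    and x: "x \<in> pts (sum_space E0 E1)" "J_rep E0 E1 x u" "in_ell p (J_seq E0 E1 \<gamma> u)"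
    and y: "y \<in> pts (sum_space F0 F1)" "J_rep F0 F1 y v" "in_ell q (J_seq F0 F1 \<rho> v)"
  obtains w where "J_rep G0 G1 (T x y) w" "in_ell r (J_seq G0 G1 \<rho> w)"
    "ell_norm r (J_seq G0 G1 \<rho> w)
     \<le> M0 * dil \<rho> (2 powi m) * (ell_norm p (J_seq E0 E1 \<gamma> u) * ell_norm q (J_seq F0 F1 \<rho> v))"
proof -
  interpret S: seminormed "sum_space G0 G1" by (rule G_sn)
  have cB: "class_B \<rho>"
    using B by (simp add: class_Bpm_def)
  note \<gamma>_pos = dual_parameter_pos[OF cB \<gamma>] and \<rho>_pos = class_B_pos[OF cB]
  define a b where "a = J_seq E0 E1 \<gamma> u" and "b = J_seq F0 F1 \<rho> v"
  have u: "u k \<in> pts E0" "u k \<in> pts E1" and v: "v k \<in> pts F0" "v k \<in> pts F1" for k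
    using J_rep_mem[OF x(2)] J_rep_mem[OF y(2)] by auto
  have ab0: "0 \<le> a k" "0 \<le> b k" for k
    unfolding a_def b_def using \<gamma>_pos \<rho>_pos
    by (auto intro!: J_seq_nonneg[OF E_sn(1) x(2)] J_seq_nonneg[OF F_sn(1) y(2)])
  note young = young_ell[OF exps x(3) ab0(1)[unfolded a_def] y(3) ab0(2)[unfolded b_def], folded a_def b_def]
  define D where "D = M0 * dil \<rho> (2 powi m)"
  have D: "0 \<le> D"
    using M_nonneg dil_pos[OF cB, of "2 powi m"] by (simp add: D_def)
  define z where "z k l = T (u k) (v l)" for k l
  have z: "z k l \<in> pts G0" "z k l \<in> pts G1" for k l
    unfolding z_def using u v by (auto intro: T_mem)
  have zS: "z k l \<in> pts (sum_space G0 G1)" for k l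
    using sum_space_left[OF G_sn(1,2) z(1)] by simp
  have Jz0: "0 \<le> J_fun G0 G1 t (z k l)" for t k l
    by (rule J_fun_nonneg[OF G_sn(1) z(1)])
  \<comment> \<open>The operator estimate on one summand is multiplied by the parameter estimate for
    the same indices; the weights of u and v then complete the two J-functionals to the entries of a
    and b.\<close>
  have Jz: "J_fun G0 G1 (2 powi n) (z k (n + m - k)) \<le> \<rho> (2 powi n) * (D * (a k * b (n + m - k)))" for n k
  proof -
    define l where "l = n + m - k"
    have "2 powi n * M1 \<le> M0 * (2 powi n * 2 powi m)"
      using mult_left_mono[OF m, of "2 powi n"] by (simp add: ac_simps)
    also have "(2::real) powi n * 2 powi m = 2 powi k * 2 powi l"
      by (simp add: l_def flip: power_int_add)
    finally have 1: "J_fun G0 G1 (2 powi n) (z k l) \<le> M0 * (J_fun E0 E1 (2 powi k) (u k) * J_fun F0 F1 (2 powi l) (v l))"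
      unfolding z_def using u v by (intro J_fun_T_le) auto
    have 2: "inverse (\<rho> (2 powi n)) \<le> dil \<rho> (2 powi m) * (inverse (\<gamma> (2 powi k)) * inverse (\<rho> (2 powi l)))"
      by (rule inverse_parameter_le[OF cB \<gamma>]) (simp_all add: l_def)
    have 0: "0 \<le> inverse (\<rho> (2 powi n))"
      using \<rho>_pos[of "2 powi n"] by simp
    have "inverse (\<rho> (2 powi n)) * J_fun G0 G1 (2 powi n) (z k l)
        \<le> (dil \<rho> (2 powi m) * (inverse (\<gamma> (2 powi k)) * inverse (\<rho> (2 powi l))))
          * (M0 * (J_fun E0 E1 (2 powi k) (u k) * J_fun F0 F1 (2 powi l) (v l)))"
      by (rule mult_mono[OF 2 1 order_trans[OF 0 2] Jz0])
    also have "\<dots> = D * (a k * b l)"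
      by (simp add: D_def a_def b_def J_seq_def ac_simps)
    finally show ?thesis
      using \<rho>_pos[of "2 powi n"] by (simp add: l_def field_simps)
  qed
  have sJz: "(\<lambda>k. J_fun G0 G1 (2 powi n) (z k (n + m - k))) summable_on UNIV" for n
    by (rule summable_on_comparison_test[OF summable_on_cmult_right[OF summable_on_cmult_right[OF young(1)]] Jz Jz0])
  \<comment> \<open>The n-th diagonal is summed with weight \<open>2 powi n\<close>. The tail
    estimates are chosen along with the sums, since they are what ties \<open>w n\<close> to the
    double series.\<close>
  have "\<forall>n. \<exists>w\<in>pts G0 \<inter> pts G1.
      J_fun G0 G1 (2 powi n) w \<le> (\<Sum>\<^sub>\<infinity>k. J_fun G0 G1 (2 powi n) (z k (n + m - k))) \<and>
      (\<forall>F. finite F \<longrightarrow> nrm (sum_space G0 G1) (w - (\<Sum>k\<in>F. z k (n + m - k)))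
        \<le> (\<Sum>\<^sub>\<infinity>k\<in>- F. nrm (sum_space G0 G1) (z k (n + m - k))))"
    by (intro allI banach_couple_series[OF G] z sJz) simp
  then obtain w where "\<forall>n. w n \<in> pts G0 \<inter> pts G1 \<and>
      J_fun G0 G1 (2 powi n) (w n) \<le> (\<Sum>\<^sub>\<infinity>k. J_fun G0 G1 (2 powi n) (z k (n + m - k))) \<and>
      (\<forall>F. finite F \<longrightarrow> nrm (sum_space G0 G1) (w n - (\<Sum>k\<in>F. z k (n + m - k)))
        \<le> (\<Sum>\<^sub>\<infinity>k\<in>- F. nrm (sum_space G0 G1) (z k (n + m - k))))"
    unfolding Bex_def by (rule choice[THEN exE])
  then have w: "\<And>n. w n \<in> pts G0 \<inter> pts G1"
    and Jw: "\<And>n. J_fun G0 G1 (2 powi n) (w n) \<le> (\<Sum>\<^sub>\<infinity>k. J_fun G0 G1 (2 powi n) (z k (n + m - k)))"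
    and tail: "\<And>n F. finite F \<Longrightarrow> nrm (sum_space G0 G1) (w n - (\<Sum>k\<in>F. z k (n + m - k)))
        \<le> (\<Sum>\<^sub>\<infinity>k\<in>- F. nrm (sum_space G0 G1) (z k (n + m - k)))"
    by blast+
  show ?thesis
  proof (rule that)
    define c where "c n = (\<Sum>\<^sub>\<infinity>k. a k * b (n - k))" for n
    have "\<bar>J_seq G0 G1 \<rho> w n\<bar> \<le> D * \<bar>c (n + m)\<bar>" for n
    proof -
      have "J_fun G0 G1 (2 powi n) (w n) \<le> (\<Sum>\<^sub>\<infinity>k. \<rho> (2 powi n) * (D * (a k * b (n + m - k))))"
        using Jw[of n] infsum_mono[OF sJz summable_on_cmult_right[OF summable_on_cmult_right[OF young(1)]] Jz]
        by (rule order_trans)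
      also have "\<dots> = \<rho> (2 powi n) * (D * c (n + m))"
        by (simp add: c_def infsum_cmult_right')
      finally have "J_seq G0 G1 \<rho> w n \<le> D * c (n + m)"
        using \<rho>_pos[of "2 powi n"] by (simp add: J_seq_def field_simps)
      moreover have "0 \<le> J_seq G0 G1 \<rho> w n"
        using \<rho>_pos[of "2 powi n"] J_fun_nonneg[OF G_sn(1), of "w n"] w by (simp add: J_seq_def)
      moreover have "0 \<le> c (n + m)"
        unfolding c_def using ab0 by (intro infsum_nonneg) auto
      ultimately show ?thesis by simp
    qed
    then have "in_ell r (J_seq G0 G1 \<rho> w) \<and> ell_norm r (J_seq G0 G1 \<rho> w) \<le> D * ell_norm r c"
      using young(2) exps(3) D by (intro ell_norm_mono_shift[of r c D _ m]) (auto simp: c_def[abs_def])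
    moreover have "D * ell_norm r c \<le> D * (ell_norm p a * ell_norm q b)"
      using young(3) D by (intro mult_left_mono) (auto simp: c_def[abs_def])
    ultimately show "in_ell r (J_seq G0 G1 \<rho> w)"
      "ell_norm r (J_seq G0 G1 \<rho> w) \<le> M0 * dil \<rho> (2 powi m) *
        (ell_norm p (J_seq E0 E1 \<gamma> u) * ell_norm q (J_seq F0 F1 \<rho> v))"
      unfolding D_def[symmetric] a_def[symmetric] b_def[symmetric] by auto
    have "bilateral_sums (sum_space G0 G1) w (T x y)"
    proof (rule S.bilateral_sums_regroup[where z = z and m = m])
      show "z k l \<in> pts (sum_space G0 G1)" for k l
        by (rule zS)
      show "T x y \<in> pts (sum_space G0 G1)"
        by (rule T_mem(1)[OF x(1) y(1)])
      show "w n \<in> pts (sum_space G0 G1)" for n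
        using sum_space_left[OF G_sn(1,2)] w by blast
      show "(\<lambda>K. nrm (sum_space G0 G1)
          (T x y - (\<Sum>k\<in>{- int K..int K}. \<Sum>l\<in>{- int K..int K}. z k l))) \<longlonglongrightarrow> 0"
        unfolding z_def by (rule T_partial_sums_tendsto[OF x(1,2) y(1,2)])
      have pq0: "0 < p" "0 < q"
        using exps(1,2) less_le_trans[of 0 "1::ereal"] by simp_all
      \<comment> \<open>Both \<rho> and \<gamma> lie below \<open>dil \<rho>\<close> at powers of 2,
        so this one series makes u and v absolutely summable.\<close>
      have s\<rho>: "(\<lambda>k::int. min 1 (2 powi (- k)) * dil \<rho> (2 powi k)) summable_on UNIV"
        by (rule summable_dil_dyadic[OF B])
      have "(\<lambda>k::int. min 1 (2 powi (- k)) * \<rho> (2 powi k)) summable_on UNIV"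
      proof (rule summable_on_comparison_test[OF s\<rho>])
        fix k :: int
        have "\<rho> (2 powi k) \<le> dil \<rho> (2 powi k)"
          using le_dil[OF cB, of "2 powi k" 1] cB by (simp add: class_B_def)
        then show "min 1 (2 powi (- k)) * \<rho> (2 powi k) \<le> min 1 (2 powi (- k)) * dil \<rho> (2 powi k)"
          by (intro mult_left_mono) auto
      qed (use \<rho>_pos in \<open>auto intro!: mult_nonneg_nonneg less_imp_le\<close>)
      then have sv: "(\<lambda>l. nrm (sum_space F0 F1) (v l)) summable_on UNIV"
        using pq0 by (intro J_rep_absolutely_summable[OF F_sn(1,2) \<rho>_pos _ y(2,3)])
      have "(\<lambda>k::int. min 1 (2 powi (- k)) * \<gamma> (2 powi k)) summable_on UNIV"
        by (rule summable_on_comparison_test[OF s\<rho>])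
          (use \<gamma>_pos dual_parameter_le_dil[OF cB \<gamma>] in
            \<open>auto intro!: mult_left_mono mult_nonneg_nonneg less_imp_le\<close>)
      then have su: "(\<lambda>k. nrm (sum_space E0 E1) (u k)) summable_on UNIV"
        using pq0 by (intro J_rep_absolutely_summable[OF E_sn(1,2) \<gamma>_pos _ x(2,3)])
      have uv: "u k \<in> pts (sum_space E0 E1)" "v k \<in> pts (sum_space F0 F1)" for k
        using sum_space_left[OF E_sn(1,2) u(1)] sum_space_left[OF F_sn(1,2) v(1)] by auto
      \<comment> \<open>Up to the norm of T on the sum spaces, the double series is dominated by the
        product of two absolutely convergent series.\<close>
      have "(\<lambda>(k, l). nrm (sum_space E0 E1) (u k) * nrm (sum_space F0 F1) (v l)) summable_on UNIV \<times> UNIV"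
        using su sv uv E_sn(3) F_sn(3)
        by (intro summable_on_SigmaI[where g = "\<lambda>k. nrm (sum_space E0 E1) (u k) * (\<Sum>\<^sub>\<infinity>l. nrm (sum_space F0 F1) (v l))"])
          (auto intro!: has_sum_cmult_right summable_on_cmult_left mult_nonneg_nonneg seminormed.nrm_nonneg)
      then have "(\<lambda>kl. bil_norm (sum_space E0 E1) (sum_space F0 F1) (sum_space G0 G1) T *
          (case kl of (k, l) \<Rightarrow> nrm (sum_space E0 E1) (u k) * nrm (sum_space F0 F1) (v l))) summable_on UNIV"
        by (intro summable_on_cmult_right) simp
      then show "(\<lambda>(k, l). nrm (sum_space G0 G1) (z k l)) summable_on UNIV"
      proof (rule summable_on_comparison_test)
        fix kl :: "int \<times> int"
        obtain k l where kl: "kl = (k, l)" by fastforce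
        show "(case kl of (k, l) \<Rightarrow> nrm (sum_space G0 G1) (z k l))
          \<le> bil_norm (sum_space E0 E1) (sum_space F0 F1) (sum_space G0 G1) T *
            (case kl of (k, l) \<Rightarrow> nrm (sum_space E0 E1) (u k) * nrm (sum_space F0 F1) (v l))"
          using bil_norm_bound(2)[OF E_sn(3) F_sn(3) G_sn(3) TS uv(1) uv(2), of k l]
          by (simp add: kl z_def mult.assoc)
        show "0 \<le> (case kl of (k, l) \<Rightarrow> nrm (sum_space G0 G1) (z k l))"
          by (simp add: kl S.nrm_nonneg zS)
      qed
    qed (rule tail)
    then show "J_rep G0 G1 (T x y) w"
      using w by (simp add: J_rep_def inter_space_def)
  qed
qed

text \<open>Near-optimal representations of x and y are fed into the convolution estimate with a
  shift m that fits the quotient of the endpoint norms; the slack e is then removed in both factors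
  together.\<close>

lemma (in bilinear_interpolation) J_space_T:
  fixes p q r :: ereal
  assumes B: "class_Bpm \<rho>" and \<gamma>: "\<And>t. t > 0 \<Longrightarrow> \<gamma> t = inverse (dil \<rho> (inverse t))"
    and exps: "1 \<le> p" "1 \<le> q" "0 < r" "1 / r = 1 / p + 1 / q - 1"
    and K: "\<And>s. s \<in> {1..2} \<Longrightarrow> dil \<rho> s \<le> K"
    and x: "x \<in> pts (J_space E0 E1 \<gamma> p)" and y: "y \<in> pts (J_space F0 F1 \<rho> q)"
  shows "T x y \<in> pts (J_space G0 G1 \<rho> r)"
    and "nrm (J_space G0 G1 \<rho> r) (T x y)
         \<le> K * M0 * dil \<rho> (M1 / M0) * nrm (J_space E0 E1 \<gamma> p) x * nrm (J_space F0 F1 \<rho> q) y"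
proof -
  have cB: "class_B \<rho>"
    using B by (simp add: class_Bpm_def)
  have xy: "x \<in> pts (sum_space E0 E1)" "y \<in> pts (sum_space F0 F1)"
    using x y by (auto simp: J_space_def)
  note Txy = T_mem(1)[OF xy]
  have "T x y \<in> pts (J_space G0 G1 \<rho> r) \<and> nrm (J_space G0 G1 \<rho> r) (T x y)
      \<le> K * M0 * dil \<rho> (M1 / M0) * nrm (J_space E0 E1 \<gamma> p) x * nrm (J_space F0 F1 \<rho> q) y"
  proof (cases "M0 = 0 \<or> M1 = 0")
    \<comment> \<open>The right side is 0 here: either M0 = 0, or the quotient is 0 and
      \<open>dil \<rho> 0 = 0\<close> by the chosen extension.\<close>
    case True
    obtain u v where "J_rep E0 E1 x u" "J_rep F0 F1 y v"
      using J_space_rep[OF x zero_less_one] J_space_rep[OF y zero_less_one] by metis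
    then have "nrm (sum_space G0 G1) (T x y) = 0"
      using T_null[OF True] xy by blast
    then show ?thesis
      using J_space_null[OF G_sn(1,2) Txy _ exps(3), of \<rho>] True by (auto simp: dil_def)
  next
    case False
    then have M: "0 < M0" "0 < M1"
      using M_nonneg by auto
    define \<mu> where "\<mu> = M1 / M0"
    \<comment> \<open>Rounding up is required for \<open>M1 \<le> M0 * 2 powi m\<close>. It leaves
      \<open>2 powi m / \<mu>\<close> in [1,2], so it costs at most the factor K.\<close>
    define m where "m = \<lceil>log 2 \<mu>\<rceil>"
    have \<mu>: "0 < \<mu>"
      using M by (simp add: \<mu>_def)
    have "(2::real) powi m = 2 powr (of_int m)"
      by (simp add: powr_real_of_int')
    moreover have "2 powr (log 2 \<mu>) \<le> (2::real) powr (of_int m)" "2 powr (of_int m) \<le> (2::real) powr (log 2 \<mu> + 1)"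
      by (intro powr_mono; simp add: m_def)+
    ultimately have m: "\<mu> \<le> 2 powi m" "2 powi m \<le> 2 * \<mu>"
      using \<mu> by (simp_all add: powr_add)
    have "dil \<rho> (\<mu> * (2 powi m / \<mu>)) \<le> dil \<rho> \<mu> * dil \<rho> (2 powi m / \<mu>)"
      using \<mu> by (intro dil_mult_le cB) auto
    also have "\<dots> \<le> dil \<rho> \<mu> * K"
      using \<mu> m dil_pos[OF cB \<mu>] by (intro mult_left_mono K) (auto simp: field_simps)
    finally have dil_m: "dil \<rho> (2 powi m) \<le> dil \<rho> \<mu> * K"
      using \<mu> by simp
    have M1_le: "M1 \<le> M0 * 2 powi m"
      using m(1) M by (simp add: \<mu>_def field_simps)
    have approx: "T x y \<in> pts (J_space G0 G1 \<rho> r) \<and> nrm (J_space G0 G1 \<rho> r) (T x y)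
        \<le> K * M0 * dil \<rho> \<mu> * (nrm (J_space E0 E1 \<gamma> p) x + e) * (nrm (J_space F0 F1 \<rho> q) y + e)"
      if e: "0 < e" for e
    proof -
      obtain u where u: "J_rep E0 E1 x u" "in_ell p (J_seq E0 E1 \<gamma> u)"
        "ell_norm p (J_seq E0 E1 \<gamma> u) < nrm (J_space E0 E1 \<gamma> p) x + e"
        using J_space_rep[OF x e] .
      obtain v where v: "J_rep F0 F1 y v" "in_ell q (J_seq F0 F1 \<rho> v)"
        "ell_norm q (J_seq F0 F1 \<rho> v) < nrm (J_space F0 F1 \<rho> q) y + e"
        using J_space_rep[OF y e] .
      obtain w where w: "J_rep G0 G1 (T x y) w" "in_ell r (J_seq G0 G1 \<rho> w)"
        and le: "ell_norm r (J_seq G0 G1 \<rho> w)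
          \<le> M0 * dil \<rho> (2 powi m) * (ell_norm p (J_seq E0 E1 \<gamma> u) * ell_norm q (J_seq F0 F1 \<rho> v))"
        using J_rep_T[OF B \<gamma> exps M1_le xy(1) u(1,2) xy(2) v(1,2)] by blast
      note le
      also have "M0 * dil \<rho> (2 powi m) * (ell_norm p (J_seq E0 E1 \<gamma> u) * ell_norm q (J_seq F0 F1 \<rho> v))
          \<le> M0 * (dil \<rho> \<mu> * K) *
            ((nrm (J_space E0 E1 \<gamma> p) x + e) * (nrm (J_space F0 F1 \<rho> q) y + e))"
      proof (rule mult_mono)
        show "M0 * dil \<rho> (2 powi m) \<le> M0 * (dil \<rho> \<mu> * K)"
          using dil_m M by simp
        have "0 \<le> dil \<rho> (2 powi m)"
          using dil_pos[OF cB, of "2 powi m"] by simp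
        then show "0 \<le> M0 * (dil \<rho> \<mu> * K)"
          using dil_m M by simp
        show "ell_norm p (J_seq E0 E1 \<gamma> u) * ell_norm q (J_seq F0 F1 \<rho> v)
            \<le> (nrm (J_space E0 E1 \<gamma> p) x + e) * (nrm (J_space F0 F1 \<rho> q) y + e)"
          by (rule mult_mono[OF less_imp_le[OF u(3)] less_imp_le[OF v(3)]
                order_trans[OF ell_norm_nonneg[OF u(2)] less_imp_le[OF u(3)]] ell_norm_nonneg[OF v(2)]])
        show "0 \<le> ell_norm p (J_seq E0 E1 \<gamma> u) * ell_norm q (J_seq F0 F1 \<rho> v)"
          by (rule mult_nonneg_nonneg[OF ell_norm_nonneg[OF u(2)] ell_norm_nonneg[OF v(2)]])
      qed
      finally have "ell_norm r (J_seq G0 G1 \<rho> w) \<le> K * M0 * dil \<rho> \<mu> *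
          (nrm (J_space E0 E1 \<gamma> p) x + e) * (nrm (J_space F0 F1 \<rho> q) y + e)"
        by (simp add: ac_simps)
      then show ?thesis
        using J_space_memI[OF Txy w] by linarith
    qed
    have "nrm (J_space G0 G1 \<rho> r) (T x y)
        \<le> K * M0 * dil \<rho> \<mu> * nrm (J_space E0 E1 \<gamma> p) x * nrm (J_space F0 F1 \<rho> q) y"
      by (rule le_product_limit) (use approx in blast)
    then show ?thesis
      using approx[OF zero_less_one] by (simp add: \<mu>_def)
  qed
  then show "T x y \<in> pts (J_space G0 G1 \<rho> r)" "nrm (J_space G0 G1 \<rho> r) (T x y)
      \<le> K * M0 * dil \<rho> (M1 / M0) * nrm (J_space E0 E1 \<gamma> p) x * nrm (J_space F0 F1 \<rho> q) y"
    by auto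
qed

section \<open>Passage to the bilinear norm\<close>

lemma (in bilinear_interpolation) bilinear_between_J_space:
  assumes "\<And>x y. x \<in> pts (J_space E0 E1 f p) \<Longrightarrow> y \<in> pts (J_space F0 F1 g q) \<Longrightarrow>
    T x y \<in> pts (J_space G0 G1 h r)"
  shows "bilinear_between (J_space E0 E1 f p) (J_space F0 F1 g q) (J_space G0 G1 h r) T"
proof -
  have sub: "x \<in> pts (sum_space X0 X1)" if "x \<in> pts (J_space X0 X1 f s)"
    for x :: "'v::real_vector" and X0 X1 f s
    using that by (simp add: J_space_def)
  have "bilinear_between (sum_space E0 E1) (sum_space F0 F1) (sum_space G0 G1) T"
    using TS by (simp add: Bil_def)
  then show ?thesis
    using assms unfolding bilinear_between_def by (meson sub)
qed

text \<open>The vectors x0 and y0 ensure that the set of unit values is nonempty, without which a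
  bound on its elements says nothing about the real supremum.\<close>

lemma bil_norm_le:
  assumes "bilinear_between X Y Z T" "x0 \<in> pts X" "nrm X x0 \<le> 1" "y0 \<in> pts Y" "nrm Y y0 \<le> 1"
    and nn: "\<And>x. x \<in> pts X \<Longrightarrow> 0 \<le> nrm X x" "\<And>y. y \<in> pts Y \<Longrightarrow> 0 \<le> nrm Y y" "0 \<le> C"
    and le: "\<And>x y. x \<in> pts X \<Longrightarrow> y \<in> pts Y \<Longrightarrow> nrm Z (T x y) \<le> C * nrm X x * nrm Y y"
  shows "T \<in> Bil X Y Z" "bil_norm X Y Z T \<le> C"
proof -
  have bound: "c \<le> C" if c: "c \<in> unit_values X Y Z T" for c
  proof -
    obtain x y where xy: "x \<in> pts X" "y \<in> pts Y" "nrm X x \<le> 1" "nrm Y y \<le> 1" "c = nrm Z (T x y)"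
      using c by (auto simp: unit_values_def)
    have "C * nrm X x * nrm Y y \<le> C * 1 * 1"
      using xy nn by (intro mult_mono) auto
    then show ?thesis
      using le[OF xy(1,2)] xy(5) by simp
  qed
  show "T \<in> Bil X Y Z"
    using assms(1) bdd_aboveI[OF bound] by (simp add: Bil_def)
  have "unit_values X Y Z T \<noteq> {}"
    using assms(2-5) unfolding unit_values_def by blast
  then show "bil_norm X Y Z T \<le> C"
    unfolding bil_norm_def using bound by (rule cSup_least)
qed

theorem theorem3p1:
  fixes \<rho> \<gamma> :: "real \<Rightarrow> real" and p q r :: ereal
  assumes rho: "class_Bpm \<rho>"
    and gamma: "\<And>t. t > 0 \<Longrightarrow> \<gamma> t = inverse (dil \<rho> (inverse t))"
    and exponents: "1 \<le> p" "1 \<le> q" "0 < r" "1 / r = 1 / p + 1 / q - 1"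
  shows "((\<forall>t>0. 0 < \<gamma> t) \<and> \<gamma> 1 = 1 \<and> (\<forall>s>0. dil_finite \<gamma> s) \<and> dil_integral \<gamma> < \<infinity> \<and>
          (continuous_on {0<..} \<gamma> \<longrightarrow> class_Bpm \<gamma>)) \<and>
         (\<exists>C>0. \<forall>(E0 :: 'e::real_vector nspace) E1 (F0 :: 'f::real_vector nspace) F1
                  (G0 :: 'g::real_vector nspace) G1 T.
            banach_couple E0 E1 \<and> banach_couple F0 F1 \<and> banach_couple G0 G1 \<and>
            T \<in> Bil (sum_space E0 E1) (sum_space F0 F1) (sum_space G0 G1) \<and>
            T \<in> Bil E0 F0 G0 \<and> T \<in> Bil E1 F1 G1
            \<longrightarrow>
            T \<in> Bil (J_space E0 E1 \<gamma> p) (J_space F0 F1 \<rho> q) (J_space G0 G1 \<rho> r) \<and>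
            bil_norm (J_space E0 E1 \<gamma> p) (J_space F0 F1 \<rho> q) (J_space G0 G1 \<rho> r) T
              \<le> C * bil_norm E0 F0 G0 T * dil \<rho> (bil_norm E1 F1 G1 T / bil_norm E0 F0 G0 T))"
proof (intro conjI)
  have B: "class_B \<rho>" and fin: "dil_integral \<rho> < \<infinity>"
    using rho by (auto simp: class_Bpm_def)
  show pos: "\<forall>t>0. 0 < \<gamma> t" and one: "\<gamma> 1 = 1" and dil: "\<forall>s>0. dil_finite \<gamma> s"
    using dual_parameter_pos[OF B gamma] dual_parameter_one[OF B gamma] dual_parameter_dil[OF B gamma]
    by auto
  show int: "dil_integral \<gamma> < \<infinity>"
    using dual_parameter_dil_integral[OF B gamma] fin by (rule le_less_trans)
  show "continuous_on {0<..} \<gamma> \<longrightarrow> class_Bpm \<gamma>"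
    using pos one dil int by (simp add: class_Bpm_def class_B_def function_parameter_def)
  obtain K where K: "1 \<le> K" "\<And>s. s \<in> {1/2..2} \<Longrightarrow> dil \<rho> s \<le> K"
    using dil_locally_bounded[OF B] by blast
  have pq: "0 < p" "0 < q"
    using exponents(1,2) less_le_trans[of 0 "1::ereal"] by simp_all
  show "\<exists>C>0. \<forall>(E0 :: 'e::real_vector nspace) E1 (F0 :: 'f::real_vector nspace) F1
                  (G0 :: 'g::real_vector nspace) G1 T.
            banach_couple E0 E1 \<and> banach_couple F0 F1 \<and> banach_couple G0 G1 \<and>
            T \<in> Bil (sum_space E0 E1) (sum_space F0 F1) (sum_space G0 G1) \<and>
            T \<in> Bil E0 F0 G0 \<and> T \<in> Bil E1 F1 G1
            \<longrightarrow>
            T \<in> Bil (J_space E0 E1 \<gamma> p) (J_space F0 F1 \<rho> q) (J_space G0 G1 \<rho> r) \<and>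
            bil_norm (J_space E0 E1 \<gamma> p) (J_space F0 F1 \<rho> q) (J_space G0 G1 \<rho> r) T
              \<le> C * bil_norm E0 F0 G0 T * dil \<rho> (bil_norm E1 F1 G1 T / bil_norm E0 F0 G0 T)"
  \<comment> \<open>K was obtained from \<rho> before any couple or operator is fixed, hence the
    uniformity of the constant.\<close>
  proof (rule exI[of _ K], intro conjI allI impI; (elim conjE)?)
    show "0 < K" using K by simp
    fix E0 E1 :: "'e nspace" and F0 F1 :: "'f nspace" and G0 G1 :: "'g nspace" and T :: "'e \<Rightarrow> 'f \<Rightarrow> 'g"
    assume "banach_couple E0 E1" "banach_couple F0 F1" "banach_couple G0 G1"
      "T \<in> Bil (sum_space E0 E1) (sum_space F0 F1) (sum_space G0 G1)" "T \<in> Bil E0 F0 G0" "T \<in> Bil E1 F1 G1"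
    then interpret bilinear_interpolation E0 E1 F0 F1 G0 G1 T
      by unfold_locales
    have K': "dil \<rho> s \<le> K" if "s \<in> {1..2}" for s
      using K(2) that by simp
    note JT = J_space_T[OF rho gamma exponents K']
    have "0 \<le> dil \<rho> (M1 / M0)"
      using dil_pos[OF B, of "M1 / M0"] by (cases "0 < M1 / M0") (auto simp: dil_def)
    then have C: "0 \<le> K * M0 * dil \<rho> (M1 / M0)"
      using K M_nonneg by simp
    have zero: "0 \<in> pts (J_space X0 X1 f s)" "nrm (J_space X0 X1 f s) 0 \<le> 1"
      if "seminormed X0" "seminormed X1" "0 < s" for X0 X1 :: "'v::real_vector nspace" and f s
      using that seminormed.zero_mem[OF seminormed_sum_space[OF that(1,2)]]
        seminormed.nrm_zero[OF seminormed_sum_space[OF that(1,2)]] J_space_null[of X0 X1 0 s f] by auto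
    note bil = bil_norm_le[OF bilinear_between_J_space[OF JT(1)] zero[OF E_sn(1,2) pq(1)] zero[OF F_sn(1,2) pq(2)]
        J_space_nrm_nonneg J_space_nrm_nonneg C JT(2)]
    show "T \<in> Bil (J_space E0 E1 \<gamma> p) (J_space F0 F1 \<rho> q) (J_space G0 G1 \<rho> r)"
      and "bil_norm (J_space E0 E1 \<gamma> p) (J_space F0 F1 \<rho> q) (J_space G0 G1 \<rho> r) T
        \<le> K * M0 * dil \<rho> (M1 / M0)"
      by (rule bil; assumption)+
  qed
qed

end
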